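(* Let $(X,Z)$ be a $\mathrm{CBITCL}(X_0,\Psi,\Phi,\Xi,\rho)$ with $b_X>0$ and suppose that, if $\psi\wedge\phi<\infty$, then $\int_1^\infty x\,e^{(\psi\wedge\phi)x}\,\pi(dx)<\infty$. For every $u\in\mathcal{X}$, define $\xi(u):=\inf\{x\in\mathcal{D}_X:\Phi(x)+\rho\,\sigma_X\sigma_Z\,u\,x+\Xi(u)\le0\}$ if $\Xi(u)\ne0$ and $\xi(u):=0$ otherwise. Then, for every $u\in\mathcal{X}$, $$\lim_{t\to+\infty}\mathcal{V}(t,0,0,u)=\xi(u)\qquad\text{and}\qquad\lim_{t\to+\infty}\frac1t\,\mathcal{U}(t,0,0,u)=\Psi(\xi(u)).$$
   Context: Parameters: $\beta\ge0$; $b_X,b_Z\in\mathbb{R}$; $\sigma_X,\sigma_Z\ge0$; $\rho\in[-1,1]$; $\nu$ a Lévy measure on $\mathbb{R}_+$ with $\int_0^1x\,\nu(dx)<\infty$; $\pi$ a Lévy measure on $\mathbb{R}_+$ with $\int_1^\infty x\,\pi(dx)<\infty$; $\gamma$ a Lévy measure on $\mathbb{R}$. Exponents: $$\Psi(u)=\beta u+\int_{\mathbb{R}_+}(e^{ux}-1)\nu(dx),\qquad\Phi(u)=-b_Xu+\tfrac12\sigma_X^2u^2+\int_{\mathbb{R}_+}(e^{ux}-1-ux)\pi(dx),$$ $$\Xi(u)=b_Zu+\tfrac12\sigma_Z^2u^2+\int_{\mathbb{R}}(e^{uz}-1-uz\mathbf{1}_{\{|z|<1\}})\gamma(dz),$$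 where $\Psi,\Phi$ are defined for complex $u$ with non-positive real part, $\Xi$ for purely imaginary $u$, and all are extended by the same formulas to real arguments (with values in $(-\infty,+\infty]$). $\mathrm{CBITCL}(X_0,\Psi,\Phi,\Xi,\rho)$, with $X_0\ge0$: a process $(X,Z)$ with values in $\mathbb{R}_+\times\mathbb{R}$ such that $X_t=X_0+M_{Y_t}+K_t$ and $Z_t=N_{Y_t}$ for all $t\ge0$, where $Y_t=\int_0^tX_s\,ds$, $K$ is a Lévy process with exponent $\Psi$ and $(M,N)$ is a two-dimensional Lévy process, independent of $K$, with exponent $\Lambda(u_1,u_2)=\Phi(u_1)+\rho\sigma_X\sigma_Zu_1u_2+\Xi(u_2)$, i.e. $\mathbb{E}[e^{u_1M_t+u_2N_t}]=e^{t\Lambda(u_1,u_2)}$ for $\mathrm{Re}\,u_1\le0$, $u_2\in\mathrm{i}\mathbb{R}$. Domains: $\mathcal{D}_X=\{u\in\mathbb{R}:\int_1^\infty e^{ux}(\nu+\pi)(dx)<\infty\}$, $\mathcal{D}_Z=\{u\in\mathbb{R}:\int_{|z|\ge1}e^{uz}\gamma(dz)<\infty\}$, $\psi=\sup\{x\ge0:\Psi(x)<\infty\}$, $\phi=\sup\{x\ge0:\Phi(x)<\infty\}$. For $u\in\mathcal{D}_Z$, $(\mathcal{U}(\cdot,0,0,u),\mathcal{V}(\cdot,0,0,u))$ is the unique solution (with $\mathcal{U}$ real-valued and $\mathcal{V}$ valued in $\mathcal{D}_X$) to $$\mathcal{U}(t,0,0,u)=\int_0^t\Psi(\mathcal{V}(s,0,0,u))\,ds,\qquad\frac{\partial\mathcal{V}}{\partial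 t}(t,0,0,u)=\Phi(\mathcal{V}(t,0,0,u))+\rho\,\sigma_X\sigma_Z\,u\,\mathcal{V}(t,0,0,u)+\Xi(u),\quad\mathcal{V}(0,0,0,u)=0,$$ on its maximal interval of existence. Let $\chi(u)=\sup\{x\in\mathcal{D}_X:\Phi(x)+\rho\,\sigma_X\sigma_Z\,u\,x+\Xi(u)\le0\}$ (with $\chi(u)=-\infty$ if the set is empty) and $\mathcal{X}=\{u\in\mathcal{D}_Z:\chi(u)\ge0\}$; for $u\in\mathcal{X}$ the solution exists for all $t\ge0$. *)

theory Defs
  imports "HOL-Probability.Probability"
begin

definition levy_measure :: "real measure \<Rightarrow> bool" where
  "levy_measure \<mu> \<longleftrightarrow> sets \<mu> = sets borel \<and> emeasure \<mu> {0} = 0 \<and>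
     (\<integral>\<^sup>+x. ennreal (min 1 (x\<^sup>2)) \<partial>\<mu>) < \<infinity>"

text \<open>A Levy measure on the half-line is represented as a Levy measure on the real line that does
  not charge the negative numbers; integrals over the half-line are then integrals over the
  whole line.\<close>

definition levy_measure_nonneg :: "real measure \<Rightarrow> bool" where
  "levy_measure_nonneg \<mu> \<longleftrightarrow> levy_measure \<mu> \<and> emeasure \<mu> {..<0} = 0"

definition levy_process :: "'a measure \<Rightarrow> (real \<Rightarrow> 'a \<Rightarrow> 'b::euclidean_space) \<Rightarrow> bool" where
  "levy_process \<Omega> L \<longleftrightarrow>
     (\<forall>t\<ge>0. L t \<in> borel_measurable \<Omega>) \<and>
     (AE \<omega> in \<Omega>. L 0 \<omega> = 0) \<and>
     (\<forall>(n::nat) (t :: nat \<Rightarrow> real). 0 \<le> t 0 \<and> mono t \<longrightarrow>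
        prob_space.indep_vars \<Omega> (\<lambda>_. borel) (\<lambda>i \<omega>. L (t (Suc i)) \<omega> - L (t i) \<omega>) {..<n}) \<and>
     (\<forall>s\<ge>0. \<forall>t\<ge>0. distr \<Omega> borel (\<lambda>\<omega>. L (s + t) \<omega> - L s \<omega>) = distr \<Omega> borel (L t)) \<and>
     (AE \<omega> in \<Omega>. \<forall>t\<ge>0. continuous (at_right t) (\<lambda>s. L s \<omega>) \<and>
        (0 < t \<longrightarrow> (\<exists>l. ((\<lambda>s. L s \<omega>) \<longlongrightarrow> l) (at_left t))))"

definition process_sigma :: "'a measure \<Rightarrow> (real \<Rightarrow> 'a \<Rightarrow> 'b::topological_space) \<Rightarrow> 'a set set" where
  "process_sigma \<Omega> L =
     sigma_sets (space \<Omega>) {L t -` B \<inter> space \<Omega> | t B. 0 \<le> t \<and> B \<in> sets borel}"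

record cbitcl_params =
  beta :: real
  b_X :: real
  b_Z :: real
  sigma_X :: real
  sigma_Z :: real
  rho :: real
  levy_nu :: "real measure"
  levy_pi :: "real measure"
  levy_gamma :: "real measure"

definition admissible :: "cbitcl_params \<Rightarrow> bool" where
  "admissible P \<longleftrightarrow>
     0 \<le> beta P \<and> 0 \<le> sigma_X P \<and> 0 \<le> sigma_Z P \<and> - 1 \<le> rho P \<and> rho P \<le> 1 \<and>
     levy_measure_nonneg (levy_nu P) \<and> (\<integral>\<^sup>+x\<in>{0..1}. ennreal x \<partial>levy_nu P) < \<infinity> \<and>
     levy_measure_nonneg (levy_pi P) \<and> (\<integral>\<^sup>+x\<in>{1..}. ennreal x \<partial>levy_pi P) < \<infinity> \<and>
     levy_measure (levy_gamma P)"

text \<open>Complex arguments: \<open>Re u \<le> 0\<close> for \<open>Psi\<close> and \<open>Phi\<close>, \<open>Re u = 0\<close> for \<open>Xi\<close>.\<close>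

definition Psi_cplx :: "cbitcl_params \<Rightarrow> complex \<Rightarrow> complex" where
  "Psi_cplx P u = of_real (beta P) * u + (\<integral>x. (exp (u * of_real x) - 1) \<partial>levy_nu P)"

definition Phi_cplx :: "cbitcl_params \<Rightarrow> complex \<Rightarrow> complex" where
  "Phi_cplx P u = - of_real (b_X P) * u + of_real ((sigma_X P)\<^sup>2 / 2) * u\<^sup>2 +
     (\<integral>x. (exp (u * of_real x) - 1 - u * of_real x) \<partial>levy_pi P)"

definition Xi_cplx :: "cbitcl_params \<Rightarrow> complex \<Rightarrow> complex" where
  "Xi_cplx P u = of_real (b_Z P) * u + of_real ((sigma_Z P)\<^sup>2 / 2) * u\<^sup>2 +
     (\<integral>z. (exp (u * of_real z) - 1 - u * of_real z * indicator {z. \<bar>z\<bar> < 1} z) \<partial>levy_gamma P)"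

definition Lambda_cplx :: "cbitcl_params \<Rightarrow> complex \<Rightarrow> complex \<Rightarrow> complex" where
  "Lambda_cplx P u1 u2 =
     Phi_cplx P u1 + of_real (rho P * sigma_X P * sigma_Z P) * u1 * u2 + Xi_cplx P u2"

text \<open>Real arguments. The integral is the difference of the integrals of the positive and the
  negative part; for the three integrands below the negative part always has a finite integral,
  so that the exponents take values in \<open>(-\<infinity>, \<infinity>]\<close>.\<close>

definition ext_integral :: "real measure \<Rightarrow> (real \<Rightarrow> real) \<Rightarrow> ereal" where
  "ext_integral \<mu> f =
     enn2ereal (\<integral>\<^sup>+x. ennreal (f x) \<partial>\<mu>) - enn2ereal (\<integral>\<^sup>+x. ennreal (- f x) \<partial>\<mu>)"

definition Psi :: "cbitcl_params \<Rightarrow> real \<Rightarrow> ereal" where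
  "Psi P u = ereal (beta P * u) + ext_integral (levy_nu P) (\<lambda>x. exp (u * x) - 1)"

definition Phi :: "cbitcl_params \<Rightarrow> real \<Rightarrow> ereal" where
  "Phi P u = ereal (- b_X P * u + (sigma_X P)\<^sup>2 / 2 * u\<^sup>2) +
     ext_integral (levy_pi P) (\<lambda>x. exp (u * x) - 1 - u * x)"

definition Xi :: "cbitcl_params \<Rightarrow> real \<Rightarrow> ereal" where
  "Xi P u = ereal (b_Z P * u + (sigma_Z P)\<^sup>2 / 2 * u\<^sup>2) +
     ext_integral (levy_gamma P) (\<lambda>z. exp (u * z) - 1 - u * z * indicator {z. \<bar>z\<bar> < 1} z)"

definition CBITCL ::
  "cbitcl_params \<Rightarrow> real \<Rightarrow> 'a measure \<Rightarrow> (real \<Rightarrow> 'a \<Rightarrow> real) \<Rightarrow> (real \<Rightarrow> 'a \<Rightarrow> real) \<Rightarrow> bool" where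
  "CBITCL P x0 \<Omega> X Z \<longleftrightarrow>
     prob_space \<Omega> \<and> 0 \<le> x0 \<and>
     (\<forall>t\<ge>0. X t \<in> borel_measurable \<Omega> \<and> Z t \<in> borel_measurable \<Omega>) \<and>
     (\<forall>t\<ge>0. \<forall>\<omega>\<in>space \<Omega>. 0 \<le> X t \<omega>) \<and>
     (\<exists>(K :: real \<Rightarrow> 'a \<Rightarrow> real) (M :: real \<Rightarrow> 'a \<Rightarrow> real) (N :: real \<Rightarrow> 'a \<Rightarrow> real).
        levy_process \<Omega> K \<and>
        levy_process \<Omega> (\<lambda>t \<omega>. (M t \<omega>, N t \<omega>)) \<and>
        prob_space.indep_set \<Omega> (process_sigma \<Omega> K) (process_sigma \<Omega> (\<lambda>t \<omega>. (M t \<omega>, N t \<omega>))) \<and>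
        (\<forall>t\<ge>0. \<forall>u. Re u \<le> 0 \<longrightarrow>
           has_bochner_integral \<Omega> (\<lambda>\<omega>. exp (u * of_real (K t \<omega>)))
             (exp (of_real t * Psi_cplx P u))) \<and>
        (\<forall>t\<ge>0. \<forall>u1 u2. Re u1 \<le> 0 \<and> Re u2 = 0 \<longrightarrow>
           has_bochner_integral \<Omega> (\<lambda>\<omega>. exp (u1 * of_real (M t \<omega>) + u2 * of_real (N t \<omega>)))
             (exp (of_real t * Lambda_cplx P u1 u2))) \<and>
        (AE \<omega> in \<Omega>. \<forall>t\<ge>0.
           set_integrable lborel {0..t} (\<lambda>s. X s \<omega>) \<and>
           (let Y = (LINT s:{0..t}|lborel. X s \<omega>)
            in X t \<omega> = x0 + M Y \<omega> + K t \<omega> \<and> Z t \<omega> = N Y \<omega>)))"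

definition D_X :: "cbitcl_params \<Rightarrow> real set" where
  "D_X P = {u. (\<integral>\<^sup>+x\<in>{1..}. ennreal (exp (u * x)) \<partial>levy_nu P) +
                (\<integral>\<^sup>+x\<in>{1..}. ennreal (exp (u * x)) \<partial>levy_pi P) < \<infinity>}"

definition D_Z :: "cbitcl_params \<Rightarrow> real set" where
  "D_Z P = {u. (\<integral>\<^sup>+z\<in>{z. 1 \<le> \<bar>z\<bar>}. ennreal (exp (u * z)) \<partial>levy_gamma P) < \<infinity>}"

definition psi_sup :: "cbitcl_params \<Rightarrow> ereal" where
  "psi_sup P = (SUP x\<in>{x. 0 \<le> x \<and> Psi P x < \<infinity>}. ereal x)"

definition phi_sup :: "cbitcl_params \<Rightarrow> ereal" where
  "phi_sup P = (SUP x\<in>{x. 0 \<le> x \<and> Phi P x < \<infinity>}. ereal x)"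

definition riccati_rhs :: "cbitcl_params \<Rightarrow> real \<Rightarrow> real \<Rightarrow> ereal" where
  "riccati_rhs P u x = Phi P x + ereal (rho P * sigma_X P * sigma_Z P * u * x) + Xi P u"

text \<open>Solutions on \<open>[0, T)\<close> with \<open>0 < T \<le> \<infinity>\<close>. On \<open>D_X P\<close> (and for \<open>u \<in> D_Z P\<close>) the functions
  \<open>Psi P\<close> and \<open>riccati_rhs P u\<close> are finite, so \<open>real_of_ereal\<close> loses nothing.\<close>

definition riccati_solution ::
  "cbitcl_params \<Rightarrow> real \<Rightarrow> ereal \<Rightarrow> (real \<Rightarrow> real) \<Rightarrow> (real \<Rightarrow> real) \<Rightarrow> bool" where
  "riccati_solution P u T U V \<longleftrightarrow> 0 < T \<and> V 0 = 0 \<and>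
     (\<forall>t. 0 \<le> t \<and> ereal t < T \<longrightarrow>
        V t \<in> D_X P \<and>
        ((\<lambda>s. real_of_ereal (Psi P (V s))) has_integral U t) {0..t} \<and>
        (V has_real_derivative real_of_ereal (riccati_rhs P u (V t)))
          (at t within {s. 0 \<le> s \<and> ereal s < T}))"

text \<open>The unique solution on its maximal interval of existence, as the common value at \<open>t\<close> of all
  solutions whose interval contains \<open>t\<close>. It is meaningful only for \<open>t\<close> below the lifetime.\<close>

definition calU :: "cbitcl_params \<Rightarrow> real \<Rightarrow> real \<Rightarrow> real" where
  "calU P u t = (THE y. \<exists>T U V. riccati_solution P u T U V \<and> 0 \<le> t \<and> ereal t < T \<and> y = U t)"

definition calV :: "cbitcl_params \<Rightarrow> real \<Rightarrow> real \<Rightarrow> real" where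
  "calV P u t = (THE y. \<exists>T U V. riccati_solution P u T U V \<and> 0 \<le> t \<and> ereal t < T \<and> y = V t)"

definition chi :: "cbitcl_params \<Rightarrow> real \<Rightarrow> ereal" where
  "chi P u = (SUP x\<in>{x \<in> D_X P. riccati_rhs P u x \<le> 0}. ereal x)"

definition calX :: "cbitcl_params \<Rightarrow> real set" where
  "calX P = {u \<in> D_Z P. 0 \<le> chi P u}"

text \<open>The infimum is taken in the reals: for \<open>u \<in> calX P\<close> the set is nonempty, and if \<open>b_X P > 0\<close>
  it is bounded below.\<close>

definition xi :: "cbitcl_params \<Rightarrow> real \<Rightarrow> real" where
  "xi P u = (if Xi P u \<noteq> 0 then Inf {x \<in> D_X P. riccati_rhs P u x \<le> 0} else 0)"

end

theory Submission
  imports Defs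
begin

text \<open>
  Write \<open>f\<close> for the right-hand side of the equation of \<open>\<V>\<close>, that is
  \<open>f x = \<Phi>(x) + \<rho> \<sigma>\<^sub>X \<sigma>\<^sub>Z u x + \<Xi>(u)\<close> on the downward closed interval \<open>\<D>\<^sub>X\<close>. The equation
  \<open>\<V>' = f(\<V>)\<close> is scalar and autonomous, so its solution from \<open>0\<close> runs monotonically towards the
  zero of \<open>f\<close> that it meets first. The theorem says that this zero is \<open>\<xi>(u)\<close>, and the limit of
  \<open>\<U>(t)/t\<close> is then the Cesaro limit of \<open>\<Psi>(\<V>(s))\<close>.

  Three properties of \<open>f\<close> carry the argument.

  First, \<open>f\<close> is Lipschitz on every compact interval inside \<open>\<D>\<^sub>X\<close> (\<open>riccati_drift_lipschitz\<close>). The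
  moment condition enters here: at a point \<open>b \<in> \<D>\<^sub>X\<close> the derivative of the jump part of \<open>\<Phi>\<close>
  is controlled by \<open>\<integral>\<^sub>1\<^sup>\<infinity> x e\<^bsup>bx\<^esup> \<pi>(dx)\<close>, and only when \<open>b\<close> is the right end of the domain can this
  fail to follow from a larger exponential moment. The Lipschitz bound gives uniqueness, by a Gronwall
  argument, and it forbids reaching a zero of \<open>f\<close> in finite time.

  Second, \<open>f\<close> tends to \<open>+\<infinity>\<close> at \<open>-\<infinity>\<close>, because \<open>b\<^sub>X > 0\<close>
  (\<open>riccati_sublevel_bdd_below\<close>). Together with \<open>\<chi>(u) \<ge> 0\<close>, this makes the infimum \<open>m\<close> of
  \<open>{f \<le> 0}\<close> a real number with \<open>f m = 0\<close> and \<open>f > 0\<close> on the left of \<open>m\<close>.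

  Third, \<open>f\<close> is convex (\<open>riccati_drift_convex\<close>). If \<open>f 0 = \<Xi>(u) > 0\<close>, a zero to the left of \<open>0\<close>
  is excluded by the point \<open>c \<ge> 0\<close> with \<open>f c \<le> 0\<close>, so that \<open>m > 0\<close> and the flow rises to \<open>m\<close>.
  If \<open>\<Xi>(u) < 0\<close>, then \<open>m < 0\<close> and \<open>f < 0\<close> on \<open>(m, 0]\<close>, so that the flow falls to \<open>m\<close>. If
  \<open>\<Xi>(u) = 0\<close>, then \<open>0\<close> is itself stationary, although \<open>m\<close> may well be negative; this is why
  \<open>\<xi>(u)\<close> is set to \<open>0\<close> in that case (\<open>xi_stationary\<close>).

  The solution itself is built as the inverse of the travel time \<open>v \<mapsto> \<integral> dx / f x\<close>
  (\<open>autonomous_flow_to_zero\<close>), which settles global existence and the limit at the same time.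
\<close>

section \<open>Scalar autonomous flows\<close>

text \<open>A particle moving with speed \<open>f\<close> needs the time \<open>\<integral>\<^sub>a\<^sup>v dx / f x\<close> to travel from \<open>a\<close> to \<open>v\<close>.
  Since \<open>f x \<le> L (b - x)\<close>, this time grows at least like \<open>- ln (b - v) / L\<close>, so \<open>b\<close> is approached
  but never reached. The flow is the inverse of the travel time.\<close>

lemma autonomous_flow_to_zero:
  fixes f :: "real \<Rightarrow> real"
  assumes ab: "a < b" and lip: "L-lipschitz_on {a..b} f"
    and pos: "\<And>x. a \<le> x \<Longrightarrow> x < b \<Longrightarrow> 0 < f x" and zero: "f b = 0"
  obtains V where "V 0 = a" "\<And>t. 0 \<le> t \<Longrightarrow> V t \<in> {a..b}"
    "\<And>t. 0 \<le> t \<Longrightarrow> (V has_real_derivative f (V t)) (at t)" "(V \<longlongrightarrow> b) at_top"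
proof -
  \<comment> \<open>Freezing the speed on the left of \<open>a\<close> makes \<open>0\<close> an interior point of the time axis, so
    that the inverse function rule yields two-sided derivatives from time \<open>0\<close> on. The integral
    starts at \<open>a - 2\<close> to make \<open>G\<close> differentiable at \<open>a - 1\<close> as well.\<close>
  define g where "g x = 1 / f (max a x)" for x
  define G where "G v = integral {a - 2..v} g - integral {a - 2..a} g" for v
  have le: "f (max a x) \<le> L * (b - max a x)" if "x < b" for x
  proof -
    have "dist (f (max a x)) (f b) \<le> L * dist (max a x) b"
      by (rule lipschitz_onD[OF lip]) (use that ab in auto)
    then show ?thesis using zero that ab by (auto simp: dist_real_def)
  qed
  have fpos: "0 < f (max a x)" if "x < b" for x
    using pos[of "max a x"] that ab by auto
  have L: "0 < L" 
    using le[of a] fpos[of a] ab by (simp add: zero_less_mult_iff)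
      (smt (verit) mult_nonpos_nonneg)
  have "continuous_on {a..b} f" by (rule lipschitz_on_continuous_on[OF lip])
  then have "continuous_on {..<b} (\<lambda>x. f (max a x))"
    by (rule continuous_on_compose2) (use ab in \<open>auto intro!: continuous_intros\<close>)
  then have cg: "continuous_on {..<b} g"
    unfolding g_def by (rule continuous_on_divide[OF continuous_on_const]) (use fpos in force)
  have G': "DERIV G v :> g v" if "a - 2 < v" "v < b" for v
  proof -
    define c where "c = (v + b) / 2"
    have c: "v < c" "c < b" using that by (auto simp: c_def)
    have "((\<lambda>x. integral {a - 2..x} g) has_real_derivative g v) (at v within {a - 2..c})"
      by (rule integral_has_real_derivative)
        (use that c in \<open>auto intro: continuous_on_subset[OF cg]\<close>)
    then have "((\<lambda>x. integral {a - 2..x} g) has_real_derivative g v) (at v)"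
      using that c by (simp add: at_within_Icc_at)
    then show ?thesis unfolding G_def
      by (auto intro!: derivative_eq_intros)
  qed
  have Ga: "G a = 0" by (simp add: G_def)
  define M where "M = L * (b - a)"
  have M: "0 < M" using L ab by (simp add: M_def)
  have gM: "1 / M \<le> g v" if "v < b" for v
  proof -
    have "f (max a v) \<le> M" using le[OF that] L unfolding M_def
      by (smt (verit) mult_left_mono)
    then show ?thesis using fpos[OF that] M by (simp add: g_def frac_le)
  qed
  have steep: "(w - v) / M \<le> G w - G v" if "a - 2 < v" "v \<le> w" "w < b" for v w
  proof -
    have "G v - v / M \<le> G w - w / M"
    proof (rule DERIV_nonneg_imp_nondecreasing[OF that(2)])
      fix x assume "v \<le> x" "x \<le> w"
      then have "DERIV (\<lambda>x. G x - x / M) x :> g x - 1 / M"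
        using that M by (auto intro!: derivative_eq_intros G')
      then show "\<exists>y. DERIV (\<lambda>x. G x - x / M) x :> y \<and> 0 \<le> y"
        using gM[of x] that \<open>x \<le> w\<close> by auto
    qed
    then show ?thesis by (simp add: diff_divide_distrib)
  qed
  have mono: "G v < G w" if "a - 2 < v" "v < w" "w < b" for v w
    using steep[of v w] that M by (smt (verit) divide_pos_pos)
  have logb: "(ln (b - a) - ln (b - v)) / L \<le> G v" if "a \<le> v" "v < b" for v
  proof -
    have "G a + ln (b - a) / L \<le> G v + ln (b - v) / L"
    proof (rule DERIV_nonneg_imp_nondecreasing[OF that(1)])
      fix x assume x: "a \<le> x" "x \<le> v"
      then have "DERIV (\<lambda>x. G x + ln (b - x) / L) x :> g x - 1 / (b - x) / L"
        using that L by (auto intro!: derivative_eq_intros G' simp: field_simps)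
      moreover have "1 / (b - x) / L \<le> g x"
        using le[of x] fpos[of x] x that L by (simp add: g_def frac_le max_def field_simps)
      ultimately show "\<exists>y. DERIV (\<lambda>x. G x + ln (b - x) / L) x :> y \<and> 0 \<le> y"
        by (intro exI[of _ "g x - 1 / (b - x) / L"]) auto
    qed
    then show ?thesis using Ga by (simp add: diff_divide_distrib)
  qed
  define I where "I = {a - 1<..<b}"
  have ex: "\<exists>v\<in>I. G v = t" if t: "G (a - 1) < t" for t
  proof -
    \<comment> \<open>The point where the logarithmic lower bound of the travel time equals \<open>\<bar>t\<bar>\<close>.\<close>
    define v where "v = b - (b - a) * exp (- L * \<bar>t\<bar>)"
    have "exp (- L * \<bar>t\<bar>) \<le> 1" using L by simp
    then have "(b - a) * exp (- L * \<bar>t\<bar>) \<le> b - a"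
      using ab by (intro mult_left_le) auto
    then have "a \<le> v" unfolding v_def by linarith
    moreover have "v < b" using ab by (simp add: v_def)
    ultimately have v: "a \<le> v" "v < b" .
    have "ln (b - v) = ln (b - a) - L * \<bar>t\<bar>"
      using ab by (simp add: v_def ln_mult)
    then have "\<bar>t\<bar> \<le> G v" using logb[OF v] L by simp
    then have "t \<le> G v" by simp
    have "continuous_on {a - 1..v} G"
      by (rule DERIV_continuous_on[where D=g], rule has_field_derivative_at_within, rule G')
        (use v in auto)
    then obtain x where "a - 1 \<le> x" "x \<le> v" "G x = t"
      using IVT'[of G "a - 1" t v] t \<open>t \<le> G v\<close> v(1) by force
    moreover have "x \<noteq> a - 1" using t \<open>G x = t\<close> by auto
    ultimately have "x \<in> I" using v(2) by (simp add: I_def)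
    then show ?thesis using \<open>G x = t\<close> by blast
  qed
  define V where "V t = (SOME v. v \<in> I \<and> G v = t)" for t
  have V: "V t \<in> I" "G (V t) = t" if "G (a - 1) < t" for t
    using someI_ex[of "\<lambda>v. v \<in> I \<and> G v = t"] ex[OF that] by (auto simp: V_def)
  have neg: "G (a - 1) < 0" using mono[of "a - 1" a] ab Ga by simp
  have below: "V t > v" if "0 \<le> t" "G v < t" "v < b" for v t
    using V[of t] mono[of "V t" v] that neg by (force simp: I_def not_less le_less)
  have Va: "a \<le> V t" if "0 \<le> t" for t
    using V[of t] mono[of "V t" a] that neg Ga ab by (force simp: I_def)
  have Vb: "V t < b" if "0 \<le> t" for t
    using V(1)[of t] that neg by (simp add: I_def)
  have contV: "isCont V t" if t: "G (a - 1) < t" for t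
  proof -
    \<comment> \<open>The speed is at most \<open>M\<close>, hence the inverse of \<open>G\<close> is \<open>M\<close>-Lipschitz.\<close>
    have lipV: "\<bar>V s - V r\<bar> \<le> M * \<bar>s - r\<bar>" if "G (a - 1) < s" "G (a - 1) < r" for s r
    proof -
      have *: "\<bar>V s - V r\<bar> \<le> M * \<bar>s - r\<bar>"
        if "G (a - 1) < s" "G (a - 1) < r" "V r \<le> V s" for s r
      proof -
        have "(V s - V r) / M \<le> s - r"
          using steep[of "V r" "V s"] V[OF that(1)] V[OF that(2)] that(3) by (simp add: I_def)
        then have "V s - V r \<le> M * (s - r)" using M by (simp add: pos_divide_le_eq mult.commute)
        also have "\<dots> \<le> M * \<bar>s - r\<bar>" using M by (intro mult_left_mono) auto
        finally show ?thesis using that(3) by simp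
      qed
      show ?thesis using *[OF that] *[OF that(2,1)] by (simp add: abs_minus_commute) linarith
    qed
    have "M-lipschitz_on {G (a - 1)<..} V"
      by (rule lipschitz_onI) (use lipV M in \<open>auto simp: dist_real_def\<close>)
    then have "continuous_on {G (a - 1)<..} V" by (rule lipschitz_on_continuous_on)
    then show ?thesis using t by (simp add: continuous_on_eq_continuous_at)
  qed
  show thesis
  proof (rule that[of V])
    show "V 0 = a"
      using V[of 0] neg mono[of "V 0" a] mono[of a "V 0"] Ga ab by (force simp: I_def)
    show "V t \<in> {a..b}" if "0 \<le> t" for t
      using Va[OF that] Vb[OF that] by simp
    show "DERIV V t :> f (V t)" if t: "0 \<le> t" for t
    proof -
      have "DERIV V t :> inverse (g (V t))"
      proof (rule DERIV_inverse_function[where f=G and a="G (a - 1)" and b="t + 1"])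
        show "DERIV G (V t) :> g (V t)"
          using V(1)[of t] neg t by (intro G') (auto simp: I_def)
        show "g (V t) \<noteq> 0" using gM[OF Vb[OF t]] M by auto
      qed (use V contV neg t in auto)
      then show ?thesis using Va[OF t] by (simp add: g_def max_def split: if_splits)
    qed
    show "(V \<longlongrightarrow> b) at_top"
    proof (rule order_tendstoI)
      fix c assume "c < b"
      then show "eventually (\<lambda>t. c < V t) at_top"
        using below by (auto simp: eventually_at_top_dense intro!: exI[of _ "max 0 (G c)"])
    next
      fix c assume "b < c"
      then show "eventually (\<lambda>t. V t < c) at_top"
        using Vb by (intro eventually_at_top_linorderI[of 0]) (rule less_trans, auto)
    qed
  qed
qed

text \<open>Gronwall: the Lipschitz bound makes \<open>(V s - W s)\<^sup>2 e\<^bsup>-2Ls\<^esup>\<close> nonincreasing, and it starts from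
  \<open>0\<close>.\<close>

lemma autonomous_flow_unique:
  fixes V W f :: "real \<Rightarrow> real"
  assumes lip: "L-lipschitz_on {a..b} f"
    and V: "\<And>s. s \<in> {0..t} \<Longrightarrow> (V has_real_derivative f (V s)) (at s within {0..t})"
    and W: "\<And>s. s \<in> {0..t} \<Longrightarrow> (W has_real_derivative f (W s)) (at s within {0..t})"
    and rV: "\<And>s. s \<in> {0..t} \<Longrightarrow> V s \<in> {a..b}" and rW: "\<And>s. s \<in> {0..t} \<Longrightarrow> W s \<in> {a..b}"
    and init: "V 0 = W 0" and t: "0 \<le> t"
  shows "V t = W t"
proof (cases "t = 0")
  case False
  define E where "E s = (V s - W s)\<^sup>2 * exp (- 2 * L * s)" for s
  define E' where "E' s = (2 * (V s - W s) * (f (V s) - f (W s)) - 2 * L * (V s - W s)\<^sup>2) * exp (- 2 * L * s)" for s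
  have "E t \<le> E 0"
  proof (rule DERIV_nonpos_imp_decreasing_open[where f=E])
    show "0 \<le> t" by (rule t)
    show "continuous_on {0..t} E" unfolding E_def
      by (intro continuous_intros DERIV_continuous_on[OF V] DERIV_continuous_on[OF W])
    fix s assume s: "0 < s" "s < t"
    have *: "DERIV V s :> f (V s)" "DERIV W s :> f (W s)"
      using V[of s] W[of s] s by (auto simp: at_within_Icc_at)
    have "DERIV E s :> E' s" unfolding E_def E'_def
      by (rule derivative_eq_intros * refl)+ (simp add: algebra_simps power2_eq_square)
    moreover have "E' s \<le> 0"
    proof -
      have "\<bar>f (V s) - f (W s)\<bar> \<le> L * \<bar>V s - W s\<bar>"
        using lipschitz_onD[OF lip, of "V s" "W s"] rV[of s] rW[of s] s by (auto simp: dist_real_def)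
      then have "\<bar>V s - W s\<bar> * \<bar>f (V s) - f (W s)\<bar> \<le> \<bar>V s - W s\<bar> * (L * \<bar>V s - W s\<bar>)"
        by (rule mult_left_mono) simp
      also have "\<dots> = L * (V s - W s)\<^sup>2" by (simp add: power2_eq_square abs_mult_self_eq algebra_simps flip: abs_mult)
      finally have "(V s - W s) * (f (V s) - f (W s)) \<le> L * (V s - W s)\<^sup>2"
        by (metis abs_ge_self abs_mult order_trans)
      then show ?thesis unfolding E'_def by (intro mult_nonpos_nonneg) (linarith, simp)
    qed
    ultimately show "\<exists>y. DERIV E s :> y \<and> y \<le> 0" by blast
  qed
  then have "(V t - W t)\<^sup>2 \<le> 0" using init
    by (simp add: E_def mult_le_0_iff not_le)
  then show ?thesis by simp
qed (use init in simp)

text \<open>The continuous Cesaro limit is an instance of the rule of l'Hospital, the integral being an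
  antiderivative of \<open>h\<close>.\<close>

lemma time_average_tendsto:
  fixes h :: "real \<Rightarrow> real"
  assumes cont: "continuous_on {0..} h" and lim: "(h \<longlongrightarrow> l) at_top"
  shows "((\<lambda>t. 1 / t * integral {0..t} h) \<longlongrightarrow> l) at_top"
proof -
  have D: "((\<lambda>t. integral {0..t} h) has_real_derivative h t) (at t)" if "0 < t" for t
    using integral_has_real_derivative[of 0 "t + 1" h t] continuous_on_subset[OF cont, of "{0..t + 1}"] that
    by (auto simp: at_within_Icc_at)
  have "((\<lambda>t. integral {0..t} h / t) \<longlongrightarrow> l) at_top"
  proof (rule lhospital_at_top_at_top[where f'=h and g'="\<lambda>_. 1"])
    show "eventually (\<lambda>t. DERIV (\<lambda>t. integral {0..t} h) t :> h t) at_top"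
      using eventually_gt_at_top[of 0] by eventually_elim (rule D)
  qed (use lim in \<open>auto simp: filterlim_ident\<close>)
  then show ?thesis by simp
qed

section \<open>Integrability and exponential bounds\<close>

lemma ext_integral_integrable:
  assumes "integrable \<mu> f"
  shows "ext_integral \<mu> f = ereal (integral\<^sup>L \<mu> f)"
proof -
  have fin: "(\<integral>\<^sup>+x. ennreal (f x) \<partial>\<mu>) < \<infinity>" "(\<integral>\<^sup>+x. ennreal (- f x) \<partial>\<mu>) < \<infinity>"
    using assms by (auto simp: real_integrable_def less_top)
  have *: "enn2ereal a - enn2ereal b = ereal (enn2real a - enn2real b)"
    if "a < \<infinity>" "b < \<infinity>" for a b
    using that by (cases a; cases b) (auto simp: enn2ereal_ennreal)
  show ?thesis
    unfolding ext_integral_def real_lebesgue_integral_def[OF assms] by (rule *[OF fin])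
qed

lemma integrable_dominated:
  fixes f g :: "'a \<Rightarrow> real"
  assumes "integrable M g" "AE x in M. \<bar>f x\<bar> \<le> g x" "f \<in> borel_measurable M"
  shows "integrable M f"
proof (rule Bochner_Integration.integrable_bound[OF assms(1,3)])
  show "AE x in M. norm (f x) \<le> norm (g x)"
    using assms(2) by eventually_elim simp
qed

lemma abs_exp_minus_one_le: "\<bar>exp y - 1\<bar> \<le> \<bar>y\<bar> * exp \<bar>y\<bar>" for y :: real
proof (cases "0 \<le> y")
  case True
  have "(1 - y) * exp y \<le> exp (- y) * exp y"
    using exp_ge_add_one_self[of "- y"] by (intro mult_right_mono) auto
  then have "exp y - 1 \<le> y * exp y" by (simp add: algebra_simps flip: exp_add)
  then show ?thesis using True by simp
next
  case False
  have "1 - exp y \<le> - y" using exp_ge_add_one_self[of y] by linarith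
  also have "\<dots> \<le> - y * exp (- y)"
    using False mult_left_mono[of 1 "exp (- y)" "- y"] by simp
  finally show ?thesis using False by simp
qed

text \<open>The tangents of \<open>exp\<close> at \<open>q\<close> and at \<open>p\<close>; they replace the mean value theorem when a difference
  of exponentials is estimated under an integral.\<close>

lemma exp_diff_bounds:
  fixes p q :: real
  shows "(p - q) * exp q \<le> exp p - exp q" "exp p - exp q \<le> (p - q) * exp p"
proof -
  have *: "(p - q) * exp q \<le> exp p - exp q" for p q :: real
  proof -
    have "(1 + (p - q)) * exp q \<le> exp (p - q) * exp q"
      by (intro mult_right_mono exp_ge_add_one_self) auto
    then show ?thesis by (simp add: algebra_simps flip: exp_add)
  qed
  show "(p - q) * exp q \<le> exp p - exp q" by (rule *)
  show "exp p - exp q \<le> (p - q) * exp p" using *[of q p] by (simp add: algebra_simps)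
qed

lemma compensated_exp_bound: "\<bar>exp y - 1 - y\<bar> \<le> y\<^sup>2 * exp \<bar>y\<bar>" for y :: real
proof -
  have "0 \<le> exp y - 1 - y" using exp_ge_add_one_self[of y] by linarith
  moreover have "exp y - 1 - y \<le> y * (exp y - 1)"
    using exp_diff_bounds(2)[of y 0] by (simp add: algebra_simps)
  moreover have "y * (exp y - 1) \<le> \<bar>y\<bar> * (\<bar>y\<bar> * exp \<bar>y\<bar>)"
  proof -
    have "y * (exp y - 1) \<le> \<bar>y\<bar> * \<bar>exp y - 1\<bar>" using abs_ge_self[of "y * (exp y - 1)"] by (simp add: abs_mult)
    also have "\<dots> \<le> \<bar>y\<bar> * (\<bar>y\<bar> * exp \<bar>y\<bar>)" by (intro mult_left_mono abs_exp_minus_one_le) simp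
    finally show ?thesis .
  qed
  moreover have "\<bar>y\<bar> * (\<bar>y\<bar> * exp \<bar>y\<bar>) = y\<^sup>2 * exp \<bar>y\<bar>"
    by (simp add: power2_eq_square flip: mult.assoc)
  ultimately show ?thesis by linarith
qed

section \<open>The exponents on their real domains\<close>

lemma levy_measure_sets: "levy_measure \<mu> \<Longrightarrow> sets \<mu> = sets borel"
  by (simp add: levy_measure_def)

lemma levy_measure_integrable_min:
  assumes "levy_measure \<mu>"
  shows "integrable \<mu> (\<lambda>x. min 1 (x\<^sup>2))"
proof -
  have [measurable_cong]: "sets \<mu> = sets borel" by (rule levy_measure_sets[OF assms])
  show ?thesis
    by (rule integrableI_nonneg) (use assms in \<open>auto simp: levy_measure_def\<close>)
qed

lemma levy_measure_nonneg_AE: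
  assumes "levy_measure_nonneg \<mu>"
  shows "AE x in \<mu>. 0 < x"
proof -
  have s: "sets \<mu> = sets borel" and n: "emeasure \<mu> {0} = 0" "emeasure \<mu> {..<0} = 0"
    using assms by (auto simp: levy_measure_nonneg_def levy_measure_def)
  have "AE x in \<mu>. x \<notin> {0}" "AE x in \<mu>. x \<notin> {..<0}"
    using n s by (intro AE_not_in null_setsI; simp)+
  then show ?thesis by eventually_elim auto
qed

lemma integrable_on_indicator:
  fixes f :: "real \<Rightarrow> real"
  assumes "sets \<mu> = sets borel" "A \<in> sets borel" "f \<in> borel_measurable borel"
    and "\<And>x. x \<in> A \<Longrightarrow> 0 \<le> f x" and "(\<integral>\<^sup>+x\<in>A. ennreal (f x) \<partial>\<mu>) < \<infinity>"
  shows "integrable \<mu> (\<lambda>x. indicator A x * f x)"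
proof (rule integrableI_nonneg)
  have [measurable_cong]: "sets \<mu> = sets borel" by fact
  note [measurable] = assms(2,3)
  show "(\<lambda>x. indicator A x * f x) \<in> borel_measurable \<mu>" by measurable
  have "(\<integral>\<^sup>+x. ennreal (indicator A x * f x) \<partial>\<mu>) = (\<integral>\<^sup>+x\<in>A. ennreal (f x) \<partial>\<mu>)"
    by (intro nn_integral_cong) (auto simp: indicator_def)
  then show "(\<integral>\<^sup>+x. ennreal (indicator A x * f x) \<partial>\<mu>) < \<infinity>" using assms(5) by simp
qed (use assms(4) in \<open>auto simp: indicator_def\<close>)

text \<open>The compensator makes the integrand quadratic near \<open>0\<close>, and the definition of \<open>\<D>\<^sub>Z\<close> bounds the
  large jumps.\<close>

lemma Xi_finite:
  assumes "admissible P" "u \<in> D_Z P"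
  obtains r where "Xi P u = ereal r"
proof -
  have levy: "levy_measure (levy_gamma P)" using assms by (simp add: admissible_def)
  note [measurable_cong] = levy_measure_sets[OF levy]
  have 1: "integrable (levy_gamma P) (\<lambda>z. (1 + u\<^sup>2 * exp \<bar>u\<bar>) * min 1 (z\<^sup>2))"
    using levy_measure_integrable_min[OF levy] by simp
  have 2: "integrable (levy_gamma P) (\<lambda>z. indicator {z. 1 \<le> \<bar>z\<bar>} z * exp (u * z))"
    by (rule integrable_on_indicator[OF levy_measure_sets[OF levy]])
      (use assms in \<open>auto simp: D_Z_def\<close>)
  have "integrable (levy_gamma P) (\<lambda>z. exp (u * z) - 1 - u * z * indicator {z. \<bar>z\<bar> < 1} z)"
  proof (rule integrable_dominated[OF Bochner_Integration.integrable_add[OF 1 2]])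
    have "\<bar>exp (u * z) - 1 - u * z * indicator {z. \<bar>z\<bar> < 1} z\<bar>
        \<le> (1 + u\<^sup>2 * exp \<bar>u\<bar>) * min 1 (z\<^sup>2) + indicator {z. 1 \<le> \<bar>z\<bar>} z * exp (u * z)" for z
    proof (cases "\<bar>z\<bar> < 1")
      case True
      have "\<bar>exp (u * z) - 1 - u * z\<bar> \<le> (u * z)\<^sup>2 * exp \<bar>u * z\<bar>" by (rule compensated_exp_bound)
      also have "\<dots> \<le> (u * z)\<^sup>2 * exp \<bar>u\<bar>"
        using True by (intro mult_left_mono) (auto simp: abs_mult mult_left_le)
      also have "\<dots> \<le> (1 + u\<^sup>2 * exp \<bar>u\<bar>) * z\<^sup>2" by (simp add: algebra_simps power_mult_distrib)
      finally have "\<bar>exp (u * z) - 1 - u * z\<bar> \<le> (1 + u\<^sup>2 * exp \<bar>u\<bar>) * z\<^sup>2" .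
      moreover have "min 1 (z\<^sup>2) = z\<^sup>2" using True by (simp add: min_absorb2 abs_square_le_1)
      ultimately show ?thesis using True by simp
    next
      case False
      then have "1 \<le> z\<^sup>2" by (simp add: abs_square_less_1 not_less[symmetric])
      then have "min 1 (z\<^sup>2) = 1" by simp
      moreover have "0 \<le> u\<^sup>2 * exp \<bar>u\<bar>" by simp
      moreover have "\<bar>exp (u * z) - 1\<bar> \<le> 1 + exp (u * z)" using exp_gt_zero[of "u * z"] by linarith
      ultimately have "\<bar>exp (u * z) - 1\<bar> \<le> (1 + u\<^sup>2 * exp \<bar>u\<bar>) * min 1 (z\<^sup>2) + exp (u * z)"
        by (simp only: mult_1_right)
      then show ?thesis using False by simp
    qed
    then show "AE z in levy_gamma P. \<bar>exp (u * z) - 1 - u * z * indicator {z. \<bar>z\<bar> < 1} z\<bar>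
      \<le> (1 + u\<^sup>2 * exp \<bar>u\<bar>) * min 1 (z\<^sup>2) + indicator {z. 1 \<le> \<bar>z\<bar>} z * exp (u * z)"
      by (rule AE_I2)
  qed measurable
  from ext_integral_integrable[OF this] have "Xi P u = ereal (b_Z P * u + (sigma_Z P)\<^sup>2 / 2 * u\<^sup>2 +
      (\<integral>z. exp (u * z) - 1 - u * z * indicator {z. \<bar>z\<bar> < 1} z \<partial>levy_gamma P))"
    unfolding Xi_def by (simp only: plus_ereal.simps)
  then show thesis by (rule that)
qed

lemma D_X_downward:
  assumes "b \<in> D_X P" "v \<le> b"
  shows "v \<in> D_X P"
proof -
  have "(\<integral>\<^sup>+x\<in>{1..}. ennreal (exp (v * x)) \<partial>\<mu>) \<le> (\<integral>\<^sup>+x\<in>{1..}. ennreal (exp (b * x)) \<partial>\<mu>)" for \<mu> :: "real measure"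
  proof (rule nn_integral_mono)
    fix x
    show "ennreal (exp (v * x)) * indicator {1..} x \<le> ennreal (exp (b * x)) * indicator {1..} x"
    proof (cases "1 \<le> x")
      case True
      then have "v * x \<le> b * x" using assms(2) by (intro mult_right_mono) auto
      then show ?thesis using True by simp
    qed simp
  qed
  from add_mono[OF this[of "levy_nu P"] this[of "levy_pi P"]] show ?thesis
    using assms(1) unfolding D_X_def mem_Collect_eq by (rule le_less_trans)
qed

lemma zero_in_D_X:
  assumes "admissible P"
  shows "0 \<in> D_X P"
proof -
  have *: "(\<integral>\<^sup>+x\<in>{1..}. ennreal (exp (0 * x)) \<partial>\<mu>) < \<infinity>" if "levy_measure \<mu>" for \<mu>
  proof -
    have "(\<integral>\<^sup>+x\<in>{1..}. ennreal (exp (0 * x)) \<partial>\<mu>) \<le> (\<integral>\<^sup>+x. ennreal (min 1 (x\<^sup>2)) \<partial>\<mu>)"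
    proof (rule nn_integral_mono)
      fix x
      show "ennreal (exp (0 * x)) * indicator {1..} x \<le> ennreal (min 1 (x\<^sup>2))"
        by (cases "1 \<le> x") simp_all
    qed
    also have "\<dots> < \<infinity>" using that unfolding levy_measure_def by blast
    finally show ?thesis .
  qed
  have "levy_measure (levy_nu P)" "levy_measure (levy_pi P)"
    using assms unfolding admissible_def levy_measure_nonneg_def by blast+
  then show ?thesis
    using *[of "levy_nu P"] *[of "levy_pi P"] unfolding D_X_def by simp
qed

lemma admissible_nu:
  assumes "admissible P"
  shows "levy_measure (levy_nu P)" "AE x in levy_nu P. 0 < x" "sets (levy_nu P) = sets borel"
    "integrable (levy_nu P) (\<lambda>x. indicator {0..1} x * x)"
proof -
  have *: "levy_measure_nonneg (levy_nu P)" "(\<integral>\<^sup>+x\<in>{0..1}. ennreal x \<partial>levy_nu P) < \<infinity>"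
    using assms unfolding admissible_def by blast+
  show "levy_measure (levy_nu P)" using *(1) unfolding levy_measure_nonneg_def by blast
  then show "sets (levy_nu P) = sets borel" by (rule levy_measure_sets)
  then show "integrable (levy_nu P) (\<lambda>x. indicator {0..1} x * x)"
    by (rule integrable_on_indicator) (use *(2) in auto)
  show "AE x in levy_nu P. 0 < x" by (rule levy_measure_nonneg_AE[OF *(1)])
qed

lemma admissible_pi:
  assumes "admissible P"
  shows "levy_measure (levy_pi P)" "AE x in levy_pi P. 0 < x" "sets (levy_pi P) = sets borel"
    "integrable (levy_pi P) (\<lambda>x. indicator {1..} x * x)"
proof -
  have *: "levy_measure_nonneg (levy_pi P)" "(\<integral>\<^sup>+x\<in>{1..}. ennreal x \<partial>levy_pi P) < \<infinity>"
    using assms unfolding admissible_def by blast+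
  show "levy_measure (levy_pi P)" using *(1) unfolding levy_measure_nonneg_def by blast
  then show "sets (levy_pi P) = sets borel" by (rule levy_measure_sets)
  then show "integrable (levy_pi P) (\<lambda>x. indicator {1..} x * x)"
    by (rule integrable_on_indicator) (use *(2) in auto)
  show "AE x in levy_pi P. 0 < x" by (rule levy_measure_nonneg_AE[OF *(1)])
qed

lemma D_X_integrable:
  assumes "admissible P" "v \<in> D_X P"
  shows "integrable (levy_nu P) (\<lambda>x. indicator {1..} x * exp (v * x))"
    and "integrable (levy_pi P) (\<lambda>x. indicator {1..} x * exp (v * x))"
  using assms(2) unfolding D_X_def
  by (auto intro!: integrable_on_indicator admissible_nu(3)[OF assms(1)] admissible_pi(3)[OF assms(1)])

text \<open>One integrable function dominates the integrands of \<open>\<Psi>\<close> for all arguments in \<open>[a, b]\<close>: small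
  jumps are summable under \<open>\<nu>\<close>, and large jumps are worst at the right end \<open>b\<close>. Both finiteness and
  continuity of \<open>\<Psi>\<close>, up to a right end that belongs to \<open>\<D>\<^sub>X\<close>, follow from it.\<close>

lemma Psi_dominated:
  assumes P: "admissible P" and b: "b \<in> D_X P"
  obtains w where "integrable (levy_nu P) w"
    "\<And>v. a \<le> v \<Longrightarrow> v \<le> b \<Longrightarrow> AE x in levy_nu P. \<bar>exp (v * x) - 1\<bar> \<le> w x"
proof -
  define m where "m = max \<bar>a\<bar> \<bar>b\<bar>"
  define w where "w x = m * exp m * (indicator {0..1} x * x)
      + (indicator {1..} x * exp (b * x) + min 1 (x\<^sup>2))" for x
  show thesis
  proof (rule that[of w])
    show "integrable (levy_nu P) w" unfolding w_def
      using admissible_nu[OF P] D_X_integrable[OF P b] levy_measure_integrable_min by simp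
    fix v assume v: "a \<le> v" "v \<le> b"
    have m: "\<bar>v\<bar> \<le> m" using v by (auto simp: m_def)
    show "AE x in levy_nu P. \<bar>exp (v * x) - 1\<bar> \<le> w x"
      using admissible_nu(2)[OF P]
    proof eventually_elim
      case (elim x)
      show ?case
      proof (cases "x < 1")
        case True
        have "\<bar>exp (v * x) - 1\<bar> \<le> \<bar>v * x\<bar> * exp \<bar>v * x\<bar>" by (rule abs_exp_minus_one_le)
        also have "\<dots> \<le> (m * x) * exp m"
          using m elim True by (intro mult_mono) (auto simp: abs_mult intro: mult_right_mono order_trans[OF mult_left_le])
        finally show ?thesis using elim True by (simp add: w_def mult_ac add_increasing2)
      next
        case False
        have "exp (v * x) \<le> exp (b * x)" using v False by (simp add: mult_right_mono)
        moreover have "1 \<le> x\<^sup>2" using False by simp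
        then have "min 1 (x\<^sup>2) = 1" by simp
        moreover have "0 \<le> m * exp m * (indicator {0..1} x * x)"
          using m False by (auto intro!: mult_nonneg_nonneg)
        moreover have "0 < exp (v * x)" by simp
        moreover have "\<bar>exp (v * x) - 1\<bar> \<le> 1 + exp (v * x)" using exp_gt_zero[of "v * x"] by linarith
        ultimately have "\<bar>exp (v * x) - 1\<bar>
            \<le> m * exp m * (indicator {0..1} x * x) + (exp (b * x) + min 1 (x\<^sup>2))"
          by linarith
        then show ?thesis using False by (simp add: w_def)
      qed
    qed
  qed
qed

lemma Psi_integrable:
  assumes P: "admissible P" and v: "v \<in> D_X P"
  shows "integrable (levy_nu P) (\<lambda>x. exp (v * x) - 1)"
proof -
  note [measurable_cong] = admissible_nu(3)[OF P]
  obtain w where "integrable (levy_nu P) w" "\<And>r. v \<le> r \<Longrightarrow> r \<le> v \<Longrightarrow> AE x in levy_nu P. \<bar>exp (r * x) - 1\<bar> \<le> w x"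
    using Psi_dominated[OF P v, of v] by metis
  then have w: "integrable (levy_nu P) w" "AE x in levy_nu P. \<bar>exp (v * x) - 1\<bar> \<le> w x"
    by auto
  then show ?thesis by (rule integrable_dominated) measurable
qed

lemma Psi_eq:
  assumes "admissible P" "v \<in> D_X P"
  shows "Psi P v = ereal (beta P * v + (\<integral>x. (exp (v * x) - 1) \<partial>levy_nu P))"
  using ext_integral_integrable[OF Psi_integrable[OF assms]] by (simp add: Psi_def)

lemma Psi_continuous:
  assumes P: "admissible P" and b: "b \<in> D_X P"
  shows "continuous_on {a..b} (\<lambda>v. real_of_ereal (Psi P v))"
proof -
  note [measurable_cong] = admissible_nu(3)[OF P]
  obtain w where w: "integrable (levy_nu P) w"
    "\<And>v. a \<le> v \<Longrightarrow> v \<le> b \<Longrightarrow> AE x in levy_nu P. \<bar>exp (v * x) - 1\<bar> \<le> w x"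
    using Psi_dominated[OF P b, of a] by metis
  have "continuous_on {a..b} (\<lambda>v. \<integral>x. (exp (v * x) - 1) \<partial>levy_nu P)"
    unfolding continuous_on_sequentially o_def
  proof (intro allI ballI impI)
    fix s :: "nat \<Rightarrow> real" and c
    assume s: "(\<forall>n. s n \<in> {a..b}) \<and> s \<longlonglongrightarrow> c"
    show "(\<lambda>n. \<integral>x. (exp (s n * x) - 1) \<partial>levy_nu P) \<longlonglongrightarrow> (\<integral>x. (exp (c * x) - 1) \<partial>levy_nu P)"
      by (rule integral_dominated_convergence[where w=w])
        (use s w in \<open>auto intro!: tendsto_intros AE_I2\<close>)
  qed
  then have "continuous_on {a..b} (\<lambda>v. beta P * v + (\<integral>x. (exp (v * x) - 1) \<partial>levy_nu P))"
    by (intro continuous_intros)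
  then show ?thesis
    by (rule continuous_on_eq) (simp add: Psi_eq[OF P D_X_downward[OF b]])
qed

lemma Phi_integrable:
  assumes P: "admissible P" and v: "v \<in> D_X P"
  shows "integrable (levy_pi P) (\<lambda>x. exp (v * x) - 1 - v * x)"
proof -
  note [measurable_cong] = admissible_pi(3)[OF P]
  define w where "w x = (1 + v\<^sup>2 * exp \<bar>v\<bar>) * min 1 (x\<^sup>2)
    + (indicator {1..} x * exp (v * x) + \<bar>v\<bar> * (indicator {1..} x * x))" for x
  have "integrable (levy_pi P) w" unfolding w_def
    using admissible_pi[OF P] D_X_integrable[OF P v] levy_measure_integrable_min by simp
  then show ?thesis
  proof (rule integrable_dominated)
    show "AE x in levy_pi P. \<bar>exp (v * x) - 1 - v * x\<bar> \<le> w x"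
      using admissible_pi(2)[OF P]
    proof eventually_elim
      case (elim x)
      show ?case
      proof (cases "x < 1")
        case True
        have "\<bar>exp (v * x) - 1 - v * x\<bar> \<le> (v * x)\<^sup>2 * exp \<bar>v * x\<bar>" by (rule compensated_exp_bound)
        also have "\<dots> \<le> (v * x)\<^sup>2 * exp \<bar>v\<bar>"
          using True elim by (intro mult_left_mono) (auto simp: abs_mult mult_left_le)
        also have "\<dots> \<le> (1 + v\<^sup>2 * exp \<bar>v\<bar>) * x\<^sup>2" by (simp add: algebra_simps power_mult_distrib)
        finally show ?thesis using True elim by (simp add: w_def min_absorb2 abs_square_le_1)
      next
        case False
        then have "1 \<le> x\<^sup>2" by simp
        then have "min 1 (x\<^sup>2) = 1" by simp
        moreover have "0 \<le> v\<^sup>2 * exp \<bar>v\<bar>" "0 < exp (v * x)" by auto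
        moreover have "\<bar>v * x\<bar> = \<bar>v\<bar> * x" using False by (simp add: abs_mult)
        ultimately have "\<bar>exp (v * x) - 1 - v * x\<bar>
            \<le> (1 + v\<^sup>2 * exp \<bar>v\<bar>) * min 1 (x\<^sup>2) + (exp (v * x) + \<bar>v\<bar> * x)"
          by (simp only: mult_1_right)
        then show ?thesis using False unfolding w_def by simp
      qed
    qed
  qed measurable
qed

lemma Phi_eq:
  assumes "admissible P" "v \<in> D_X P"
  shows "Phi P v = ereal (- b_X P * v + (sigma_X P)\<^sup>2 / 2 * v\<^sup>2 + (\<integral>x. (exp (v * x) - 1 - v * x) \<partial>levy_pi P))"
  using ext_integral_integrable[OF Phi_integrable[OF assms]] by (simp add: Phi_def)

section \<open>The moment condition and the Lipschitz bound\<close>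

text \<open>Finiteness of \<open>\<Phi>\<close> is stated through an extended integral. As the compensated exponential is
  nonnegative and the first moment of the large jumps is finite, it amounts to an exponential moment.\<close>

lemma Phi_finite_imp_exp_moment:
  assumes P: "admissible P" and y: "Phi P y < \<infinity>"
  shows "integrable (levy_pi P) (\<lambda>x. indicator {1..} x * exp (y * x))"
proof -
  note [measurable_cong] = admissible_pi(3)[OF P]
  have nonneg: "0 \<le> exp (y * x) - 1 - y * x" for x using exp_ge_add_one_self[of "y * x"] by linarith
  have zero: "(\<integral>\<^sup>+x. ennreal (- (exp (y * x) - 1 - y * x)) \<partial>levy_pi P) = 0"
    using nonneg by (simp add: ennreal_neg)
  have "(\<integral>\<^sup>+x. ennreal (exp (y * x) - 1 - y * x) \<partial>levy_pi P) < \<infinity>"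
    using y unfolding Phi_def ext_integral_def zero
    by (cases "\<integral>\<^sup>+x. ennreal (exp (y * x) - 1 - y * x) \<partial>levy_pi P") auto
  then have 1: "integrable (levy_pi P) (\<lambda>x. exp (y * x) - 1 - y * x)"
    using nonneg by (intro integrableI_nonneg) auto
  have 2: "integrable (levy_pi P) (\<lambda>x. min 1 (x\<^sup>2) + \<bar>y\<bar> * (indicator {1..} x * x))"
    using admissible_pi[OF P] levy_measure_integrable_min by simp
  show ?thesis
  proof (rule integrable_dominated[OF Bochner_Integration.integrable_add[OF 1 2]])
    have "indicator {1..} x * exp (y * x) \<le> (exp (y * x) - 1 - y * x) + (min 1 (x\<^sup>2) + \<bar>y\<bar> * (indicator {1..} x * x))" for x
    proof (cases "1 \<le> x")
      case True
      then have "min 1 (x\<^sup>2) = 1" by simp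
      moreover have "y * x \<le> \<bar>y\<bar> * x" using True by (intro mult_right_mono) auto
      ultimately show ?thesis using True by simp
    next
      case False
      then show ?thesis using nonneg[of x] by simp
    qed
    moreover have "\<bar>indicator {1..} x * exp (y * x)\<bar> = indicator {1..} x * exp (y * x)" for x :: real
      by (simp add: abs_mult)
    ultimately show "AE x in levy_pi P. \<bar>indicator {1..} x * exp (y * x)\<bar>
      \<le> (exp (y * x) - 1 - y * x) + (min 1 (x\<^sup>2) + \<bar>y\<bar> * (indicator {1..} x * x))"
      by (intro AE_I2) (simp only:)
  qed measurable
qed

text \<open>When \<open>\<psi> \<and> \<phi>\<close> is finite, it is the right end of \<open>\<D>\<^sub>X\<close>, and the condition says that \<open>\<Phi>\<close>
  has a finite left derivative there.\<close>

definition endpoint_moment :: "cbitcl_params \<Rightarrow> bool" where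
  "endpoint_moment P \<longleftrightarrow> (min (psi_sup P) (phi_sup P) < \<infinity> \<longrightarrow>
    (\<integral>\<^sup>+x\<in>{1..}. ennreal (x * exp (real_of_ereal (min (psi_sup P) (phi_sup P)) * x)) \<partial>levy_pi P) < \<infinity>)"

text \<open>If \<open>\<psi> \<and> \<phi>\<close> is finite, then every point of \<open>\<D>\<^sub>X\<close> lies below it and the moment condition applies
  directly. Otherwise \<open>\<phi> = \<infinity>\<close>, and the factor \<open>x\<close> is absorbed by an exponential moment of a larger
  order \<open>y\<close>, since \<open>(y - b) x \<le> e\<^bsup>(y - b)x\<^esup>\<close>.\<close>

lemma exp_first_moment:
  assumes P: "admissible P"
    and endpoint: "endpoint_moment P"
    and b: "b \<in> D_X P"
  shows "integrable (levy_pi P) (\<lambda>x. indicator {1..} x * (x * exp (b * x)))"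
proof (cases "min (psi_sup P) (phi_sup P) < \<infinity>")
  case True
  note [measurable_cong] = admissible_pi(3)[OF P]
  have mem: "ereal d \<le> min (psi_sup P) (phi_sup P)" if "0 \<le> d" "d \<in> D_X P" for d
    using that Psi_eq[OF P that(2)] Phi_eq[OF P that(2)]
    unfolding psi_sup_def phi_sup_def by (auto intro!: SUP_upper)
  define c where "c = real_of_ereal (min (psi_sup P) (phi_sup P))"
  have "0 \<le> min (psi_sup P) (phi_sup P)" using mem[OF _ zero_in_D_X[OF P]] by (simp add: zero_ereal_def)
  then have c: "min (psi_sup P) (phi_sup P) = ereal c"
    using True by (cases "min (psi_sup P) (phi_sup P)") (auto simp: c_def)
  have bc: "b \<le> c"
    using mem[of b] b \<open>0 \<le> min (psi_sup P) (phi_sup P)\<close> by (cases "0 \<le> b") (auto simp: c)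
  have "integrable (levy_pi P) (\<lambda>x. indicator {1..} x * (x * exp (c * x)))"
    by (rule integrable_on_indicator[OF admissible_pi(3)[OF P]])
      (use endpoint True in \<open>auto simp: c_def endpoint_moment_def\<close>)
  then show ?thesis
  proof (rule integrable_dominated)
    show "AE x in levy_pi P. \<bar>indicator {1..} x * (x * exp (b * x))\<bar> \<le> indicator {1..} x * (x * exp (c * x))"
      using admissible_pi(2)[OF P]
      by eventually_elim (use bc in \<open>simp add: abs_mult mult_left_mono\<close>)
  qed measurable
next
  case False
  note [measurable_cong] = admissible_pi(3)[OF P]
  from False have "phi_sup P = \<infinity>" by (simp add: not_less min_def split: if_splits)
  then have "ereal b < phi_sup P" by simp
  then obtain y where y: "Phi P y < \<infinity>" "b < y" by (auto simp: phi_sup_def less_SUP_iff)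
  from Phi_finite_imp_exp_moment[OF P y(1)]
  have "integrable (levy_pi P) (\<lambda>x. 1 / (y - b) * (indicator {1..} x * exp (y * x)))" by simp
  then show ?thesis
  proof (rule integrable_dominated)
    have le: "x * exp (b * x) \<le> 1 / (y - b) * exp (y * x)" for x
    proof -
      have "(y - b) * x \<le> exp ((y - b) * x)" using exp_ge_add_one_self[of "(y - b) * x"] by linarith
      then have "(y - b) * x * exp (b * x) \<le> exp ((y - b) * x) * exp (b * x)"
        by (intro mult_right_mono) auto
      also have "\<dots> = exp (y * x)" by (simp add: algebra_simps flip: exp_add)
      finally show ?thesis using y(2) by (simp add: field_simps)
    qed
    show "AE x in levy_pi P. \<bar>indicator {1..} x * (x * exp (b * x))\<bar>
      \<le> 1 / (y - b) * (indicator {1..} x * exp (y * x))"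
      using admissible_pi(2)[OF P]
    proof eventually_elim
      case (elim x)
      then show ?case using le[of x] by (cases "1 \<le> x") (simp_all add: abs_mult)
    qed
  qed measurable
qed

text \<open>The derivative of \<open>v \<mapsto> e\<^bsup>vx\<^esup> - 1 - vx\<close> is \<open>x (e\<^bsup>vx\<^esup> - 1)\<close>. For \<open>v\<close> in \<open>[a, b]\<close> it is of order \<open>x\<^sup>2\<close>
  for small \<open>x\<close> and at most \<open>x (1 + e\<^bsup>bx\<^esup>)\<close> for large \<open>x\<close>; the integral of this bound is a Lipschitz
  constant.\<close>

lemma Phi_lipschitz:
  assumes P: "admissible P"
    and endpoint: "endpoint_moment P"
    and b: "b \<in> D_X P"
  obtains L where "L-lipschitz_on {a..b} (\<lambda>v. \<integral>x. (exp (v * x) - 1 - v * x) \<partial>levy_pi P)"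
proof -
  define m where "m = max \<bar>a\<bar> \<bar>b\<bar>"
  define w where "w x = m * exp m * min 1 (x\<^sup>2)
      + (indicator {1..} x * x + indicator {1..} x * (x * exp (b * x)))" for x
  have w: "integrable (levy_pi P) w" unfolding w_def
    using admissible_pi[OF P] exp_first_moment[OF P endpoint b] levy_measure_integrable_min by simp
  have slope: "\<bar>x * (exp (v * x) - 1)\<bar> \<le> w x" if v: "a \<le> v" "v \<le> b" and x: "0 < x" for v x
  proof (cases "x < 1")
    case True
    have m: "\<bar>v\<bar> \<le> m" using v by (auto simp: m_def)
    have "\<bar>exp (v * x) - 1\<bar> \<le> \<bar>v * x\<bar> * exp \<bar>v * x\<bar>" by (rule abs_exp_minus_one_le)
    also have "\<dots> \<le> (m * x) * exp m"
      using m x True by (intro mult_mono) (auto simp: abs_mult intro: mult_right_mono order_trans[OF mult_left_le])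
    finally have "\<bar>x * (exp (v * x) - 1)\<bar> \<le> x * ((m * x) * exp m)"
      using x by (simp add: abs_mult)
    also have "\<dots> = m * exp m * x\<^sup>2" by (simp add: power2_eq_square)
    finally have "\<bar>x * (exp (v * x) - 1)\<bar> \<le> m * exp m * x\<^sup>2" .
    moreover have "min 1 (x\<^sup>2) = x\<^sup>2" using x True by (simp add: min_absorb2 abs_square_le_1)
    ultimately show ?thesis using x True by (simp add: w_def)
  next
    case False
    have "\<bar>exp (v * x) - 1\<bar> \<le> 1 + exp (v * x)" using exp_gt_zero[of "v * x"] by linarith
    also have "exp (v * x) \<le> exp (b * x)" using v x by (simp add: mult_right_mono)
    finally have "x * \<bar>exp (v * x) - 1\<bar> \<le> x * (1 + exp (b * x))" using x by (intro mult_left_mono) auto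
    moreover have "0 \<le> m * exp m * min 1 (x\<^sup>2)" by (auto simp: m_def)
    moreover have "\<bar>x * (exp (v * x) - 1)\<bar> = x * \<bar>exp (v * x) - 1\<bar>" using x by (simp add: abs_mult)
    ultimately have "\<bar>x * (exp (v * x) - 1)\<bar> \<le> m * exp m * min 1 (x\<^sup>2) + x * (1 + exp (b * x))"
      by linarith
    then show ?thesis using False unfolding w_def by (simp add: distrib_left)
  qed
  have key: "\<bar>(\<integral>x. (exp (v * x) - 1 - v * x) \<partial>levy_pi P) - (\<integral>x. (exp (r * x) - 1 - r * x) \<partial>levy_pi P)\<bar>
      \<le> integral\<^sup>L (levy_pi P) w * \<bar>v - r\<bar>" if "a \<le> r" "r \<le> v" "v \<le> b" for v r
  proof -
    have i: "integrable (levy_pi P) (\<lambda>x. exp (v * x) - 1 - v * x)"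
      "integrable (levy_pi P) (\<lambda>x. exp (r * x) - 1 - r * x)"
      using that D_X_downward[OF b] by (auto intro!: Phi_integrable[OF P])
    have "\<bar>(\<integral>x. (exp (v * x) - 1 - v * x) \<partial>levy_pi P) - (\<integral>x. (exp (r * x) - 1 - r * x) \<partial>levy_pi P)\<bar>
      = \<bar>\<integral>x. (exp (v * x) - 1 - v * x) - (exp (r * x) - 1 - r * x) \<partial>levy_pi P\<bar>"
      by (subst Bochner_Integration.integral_diff[OF i]) (rule refl)
    also have "\<dots> \<le> (\<integral>x. \<bar>(exp (v * x) - 1 - v * x) - (exp (r * x) - 1 - r * x)\<bar> \<partial>levy_pi P)"
      by (rule integral_abs_bound)
    also have "\<dots> \<le> (\<integral>x. w x * \<bar>v - r\<bar> \<partial>levy_pi P)"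
    proof (rule integral_mono_AE)
      show "integrable (levy_pi P) (\<lambda>x. \<bar>(exp (v * x) - 1 - v * x) - (exp (r * x) - 1 - r * x)\<bar>)"
        by (rule integrable_abs[OF Bochner_Integration.integrable_diff[OF i]])
      show "integrable (levy_pi P) (\<lambda>x. w x * \<bar>v - r\<bar>)" using w by simp
      show "AE x in levy_pi P. \<bar>(exp (v * x) - 1 - v * x) - (exp (r * x) - 1 - r * x)\<bar> \<le> w x * \<bar>v - r\<bar>"
        using admissible_pi(2)[OF P]
      proof eventually_elim
        case (elim x)
        have "(v - r) * (x * (exp (r * x) - 1)) \<le> (exp (v * x) - 1 - v * x) - (exp (r * x) - 1 - r * x)"
          using exp_diff_bounds(1)[of "v * x" "r * x"] by (simp add: algebra_simps)
        moreover have "(exp (v * x) - 1 - v * x) - (exp (r * x) - 1 - r * x) \<le> (v - r) * (x * (exp (v * x) - 1))"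
          using exp_diff_bounds(2)[of "v * x" "r * x"] by (simp add: algebra_simps)
        moreover have "(v - r) * (x * (exp (v * x) - 1)) \<le> (v - r) * w x"
          using slope[of v x] that elim by (intro mult_left_mono) auto
        moreover have "(v - r) * (- w x) \<le> (v - r) * (x * (exp (r * x) - 1))"
          using slope[of r x] that elim by (intro mult_left_mono) auto
        moreover have "w x * \<bar>v - r\<bar> = (v - r) * w x" using that by simp
        ultimately show ?case unfolding mult_minus_right by linarith
      qed
    qed
    also have "\<dots> = integral\<^sup>L (levy_pi P) w * \<bar>v - r\<bar>" by simp
    finally show ?thesis .
  qed
  have "0 \<le> integral\<^sup>L (levy_pi P) w"
  proof (rule integral_nonneg_AE)
    show "AE x in levy_pi P. 0 \<le> w x"
      using admissible_pi(2)[OF P] by eventually_elim (simp add: w_def m_def)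
  qed
  have "(integral\<^sup>L (levy_pi P) w)-lipschitz_on {a..b} (\<lambda>v. \<integral>x. (exp (v * x) - 1 - v * x) \<partial>levy_pi P)"
  proof (rule lipschitz_onI[rotated])
    fix v r assume "v \<in> {a..b}" "r \<in> {a..b}"
    then show "dist (\<integral>x. (exp (v * x) - 1 - v * x) \<partial>levy_pi P) (\<integral>x. (exp (r * x) - 1 - r * x) \<partial>levy_pi P)
      \<le> integral\<^sup>L (levy_pi P) w * dist v r"
      using key[of r v] key[of v r] unfolding dist_real_def atLeastAtMost_iff
      by (cases "r \<le> v") (simp_all add: abs_minus_commute)
  qed fact
  then show thesis by (rule that)
qed

section \<open>The Riccati drift\<close>

text \<open>The drift \<open>f\<close> as a real function; it is meaningful on \<open>\<D>\<^sub>X\<close>, where the extended value is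
  finite.\<close>

definition riccati_drift :: "cbitcl_params \<Rightarrow> real \<Rightarrow> real \<Rightarrow> real" where
  "riccati_drift P u x = real_of_ereal (riccati_rhs P u x)"

lemma riccati_drift_formula:
  assumes "admissible P" "u \<in> D_Z P" "x \<in> D_X P"
  shows "riccati_drift P u x = (rho P * sigma_X P * sigma_Z P * u - b_X P) * x + (sigma_X P)\<^sup>2 / 2 * x\<^sup>2
      + real_of_ereal (Xi P u) + (\<integral>y. (exp (x * y) - 1 - x * y) \<partial>levy_pi P)"
    and "riccati_rhs P u x = ereal (riccati_drift P u x)"
proof -
  obtain r where "Xi P u = ereal r" using Xi_finite[OF assms(1,2)] .
  then show *: "riccati_drift P u x = (rho P * sigma_X P * sigma_Z P * u - b_X P) * x + (sigma_X P)\<^sup>2 / 2 * x\<^sup>2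
      + real_of_ereal (Xi P u) + (\<integral>y. (exp (x * y) - 1 - x * y) \<partial>levy_pi P)"
    "riccati_rhs P u x = ereal (riccati_drift P u x)"
    unfolding riccati_drift_def riccati_rhs_def Phi_eq[OF assms(1,3)] by (simp_all add: algebra_simps)
qed

lemma quadratic_lipschitz:
  fixes p q r a b :: real
  shows "(\<bar>p\<bar> + \<bar>q\<bar> * (2 * max \<bar>a\<bar> \<bar>b\<bar>))-lipschitz_on {a..b} (\<lambda>x. p * x + q * x\<^sup>2 + r)"
proof (rule lipschitz_onI)
  fix x y assume xy: "x \<in> {a..b}" "y \<in> {a..b}"
  have "(p * x + q * x\<^sup>2 + r) - (p * y + q * y\<^sup>2 + r) = (p + q * (x + y)) * (x - y)"
    by (simp add: algebra_simps power2_eq_square)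
  moreover have "\<bar>p + q * (x + y)\<bar> \<le> \<bar>p\<bar> + \<bar>q\<bar> * (2 * max \<bar>a\<bar> \<bar>b\<bar>)"
  proof -
    have "\<bar>x + y\<bar> \<le> 2 * max \<bar>a\<bar> \<bar>b\<bar>" using xy by auto
    then have "\<bar>q * (x + y)\<bar> \<le> \<bar>q\<bar> * (2 * max \<bar>a\<bar> \<bar>b\<bar>)"
      unfolding abs_mult by (rule mult_left_mono) simp
    then show ?thesis by linarith
  qed
  ultimately show "dist (p * x + q * x\<^sup>2 + r) (p * y + q * y\<^sup>2 + r)
      \<le> (\<bar>p\<bar> + \<bar>q\<bar> * (2 * max \<bar>a\<bar> \<bar>b\<bar>)) * dist x y"
    unfolding dist_real_def by (simp add: abs_mult mult_right_mono)
qed simp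

lemma riccati_drift_lipschitz:
  assumes P: "admissible P" "endpoint_moment P" "u \<in> D_Z P" and b: "b \<in> D_X P"
  obtains L where "L-lipschitz_on {a..b} (riccati_drift P u)"
proof -
  obtain L where L: "L-lipschitz_on {a..b} (\<lambda>v. \<integral>x. (exp (v * x) - 1 - v * x) \<partial>levy_pi P)"
    using Phi_lipschitz[OF P(1,2) b] .
  show thesis
    by (rule that, rule lipschitz_on_transform[OF lipschitz_on_add[OF
          quadratic_lipschitz[of "rho P * sigma_X P * sigma_Z P * u - b_X P" "(sigma_X P)\<^sup>2 / 2"
            a b "real_of_ereal (Xi P u)"] L]])
       (simp add: riccati_drift_formula(1)[OF P(1,3) D_X_downward[OF b]])
qed

lemma riccati_drift_continuous:
  assumes P: "admissible P" "endpoint_moment P" "u \<in> D_Z P" and b: "b \<in> D_X P"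
  shows "continuous_on {a..b} (riccati_drift P u)"
  using riccati_drift_lipschitz[OF assms] lipschitz_on_continuous_on by metis

text \<open>A quadratic polynomial with nonnegative leading coefficient plus an average of convex
  functions.\<close>

lemma riccati_drift_convex:
  assumes P: "admissible P" "u \<in> D_Z P" and x: "x \<in> D_X P" and y: "y \<in> D_X P" and t: "0 \<le> t" "t \<le> 1"
  shows "riccati_drift P u ((1 - t) * x + t * y) \<le> (1 - t) * riccati_drift P u x + t * riccati_drift P u y"
proof -
  define z where "z = (1 - t) * x + t * y"
  have "z \<le> (1 - t) * max x y + t * max x y"
    unfolding z_def using t by (intro add_mono mult_left_mono) auto
  then have "z \<le> max x y" by (simp add: algebra_simps)
  then have z: "z \<in> D_X P" using D_X_downward x y by (auto simp: max_def split: if_splits)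
  note int = Phi_integrable[OF P(1)]
  have "(\<integral>w. (exp (z * w) - 1 - z * w) \<partial>levy_pi P)
      \<le> (\<integral>w. (1 - t) * (exp (x * w) - 1 - x * w) + t * (exp (y * w) - 1 - y * w) \<partial>levy_pi P)"
  proof (rule integral_mono)
    show "integrable (levy_pi P) (\<lambda>w. exp (z * w) - 1 - z * w)" by (rule int[OF z])
    show "integrable (levy_pi P) (\<lambda>w. (1 - t) * (exp (x * w) - 1 - x * w) + t * (exp (y * w) - 1 - y * w))"
      by (rule Bochner_Integration.integrable_add[OF integrable_mult_right integrable_mult_right])
        (use int[OF x] int[OF y] in auto)
    fix w
    have "exp ((1 - t) *\<^sub>R (x * w) + t *\<^sub>R (y * w)) \<le> (1 - t) * exp (x * w) + t * exp (y * w)"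
      using t by (intro convex_onD[OF exp_convex]) auto
    then show "exp (z * w) - 1 - z * w \<le> (1 - t) * (exp (x * w) - 1 - x * w) + t * (exp (y * w) - 1 - y * w)"
      by (simp add: z_def algebra_simps)
  qed
  also have "\<dots> = (1 - t) * (\<integral>w. (exp (x * w) - 1 - x * w) \<partial>levy_pi P)
      + t * (\<integral>w. (exp (y * w) - 1 - y * w) \<partial>levy_pi P)"
    by (subst Bochner_Integration.integral_add[OF integrable_mult_right integrable_mult_right])
      (use int[OF x] int[OF y] in auto)
  finally have jump: "(\<integral>w. (exp (z * w) - 1 - z * w) \<partial>levy_pi P) \<le> \<dots>" .
  \<comment> \<open>The convexity defect of the square.\<close>
  have "z\<^sup>2 = (1 - t) * x\<^sup>2 + t * y\<^sup>2 - t * (1 - t) * (x - y)\<^sup>2"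
    by (simp add: z_def power2_eq_square algebra_simps)
  then have "z\<^sup>2 \<le> (1 - t) * x\<^sup>2 + t * y\<^sup>2" using t by simp
  moreover define q where "q = (sigma_X P)\<^sup>2 / 2"
  moreover have "0 \<le> q" by (simp add: q_def)
  ultimately have "q * z\<^sup>2 \<le> q * ((1 - t) * x\<^sup>2 + t * y\<^sup>2)"
    by (intro mult_left_mono)
  moreover define p where "p = rho P * sigma_X P * sigma_Z P * u - b_X P"
  moreover have "p * z = p * ((1 - t) * x + t * y)" by (simp add: z_def)
  ultimately have "riccati_drift P u z \<le> (1 - t) * riccati_drift P u x + t * riccati_drift P u y"
    unfolding riccati_drift_formula(1)[OF P x] riccati_drift_formula(1)[OF P y]
      riccati_drift_formula(1)[OF P z] p_def[symmetric] q_def[symmetric]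
    using jump by (simp only: ring_distribs) (simp add: mult_ac)
  then show ?thesis by (simp only: z_def)
qed

text \<open>At \<open>- y\<close> with \<open>y \<ge> 0\<close> the jump part of \<open>\<Phi>\<close> is nonnegative, which leaves a polynomial in \<open>y\<close>. If
  \<open>\<sigma>\<^sub>X \<noteq> 0\<close>, its quadratic term beats the correlation term; if \<open>\<sigma>\<^sub>X = 0\<close>, the correlation term
  vanishes and \<open>b\<^sub>X y\<close> dominates.\<close>

lemma riccati_sublevel_bdd_below:
  assumes P: "admissible P" "u \<in> D_Z P" and b: "0 < b_X P"
  shows "bdd_below {x \<in> D_X P. riccati_drift P u x \<le> 0}"
proof -
  define r where "r = \<bar>real_of_ereal (Xi P u)\<bar>"
  define k where "k = \<bar>rho P * sigma_X P * sigma_Z P * u\<bar>"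
  define s where "s = (sigma_X P)\<^sup>2 / 2"
  have r: "0 \<le> r" unfolding r_def by (rule abs_ge_zero)
  have lower: "(b_X P - k) * y + s * y\<^sup>2 - r \<le> riccati_drift P u (- y)" if y: "0 \<le> y" for y
  proof -
    have D: "- y \<in> D_X P" using D_X_downward[OF zero_in_D_X[OF P(1)]] y by simp
    have "0 \<le> (\<integral>w. (exp (- y * w) - 1 - - y * w) \<partial>levy_pi P)"
      by (rule integral_nonneg_AE, rule AE_I2) (use exp_ge_add_one_self in \<open>smt (verit)\<close>)
    moreover have "rho P * sigma_X P * sigma_Z P * u * y \<le> k * y"
      unfolding k_def using y by (intro mult_right_mono) auto
    moreover have "- r \<le> real_of_ereal (Xi P u)" unfolding r_def by linarith
    ultimately show ?thesis
      unfolding riccati_drift_formula(1)[OF P D] s_def by (simp add: algebra_simps)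
  qed
  show ?thesis
  proof (cases "sigma_X P = 0")
    case True
    then have "k = 0" "s = 0" by (auto simp: k_def s_def)
    show ?thesis
    proof (rule bdd_belowI)
      fix x assume x: "x \<in> {x \<in> D_X P. riccati_drift P u x \<le> 0}"
      show "- (r / b_X P) \<le> x"
      proof (cases "0 \<le> x")
        case True
        have "0 \<le> r / b_X P" using b unfolding r_def by (intro divide_nonneg_pos abs_ge_zero)
        with True show ?thesis by simp
      next
        case False
        then have "b_X P * (- x) \<le> r" using lower[of "- x"] x \<open>k = 0\<close> \<open>s = 0\<close> by simp
        then have "- x \<le> r / b_X P" using b by (simp add: field_simps)
        then show ?thesis by simp
      qed
    qed
  next
    case False
    then have s: "0 < s" by (simp add: s_def)
    show ?thesis
    proof (rule bdd_belowI)
      fix x assume x: "x \<in> {x \<in> D_X P. riccati_drift P u x \<le> 0}"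
      \<comment> \<open>Beyond \<open>c\<close> the factor \<open>s y\<close> exceeds \<open>k + r\<close>, and \<open>y \<ge> 1\<close>, so \<open>s y\<^sup>2 > k y + r\<close>.\<close>
      define c where "c = (k + r) / s + 1"
      have "0 \<le> (k + r) / s" using s unfolding k_def r_def by (intro divide_nonneg_pos add_nonneg_nonneg abs_ge_zero)
      then have c: "1 \<le> c" by (simp add: c_def)
      show "- c \<le> x"
      proof (rule ccontr)
        assume "\<not> - c \<le> x"
        then have y: "c < - x" by simp
        have "k + r < s * c" using s by (simp add: c_def field_simps)
        also have "\<dots> \<le> s * (- x)" using s y by (intro mult_left_mono) auto
        finally have "(k + r) * (- x) < s * (- x) * (- x)"
          using y c by (intro mult_strict_right_mono) auto
        moreover have "r * 1 \<le> r * (- x)" using y c by (intro mult_left_mono) (use r in auto)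
        moreover have "0 \<le> b_X P * (- x)" using b y c by (intro mult_nonneg_nonneg) auto
        ultimately have "0 < (b_X P - k) * (- x) + s * (- x)\<^sup>2 - r"
          by (simp add: algebra_simps power2_eq_square)
        then show False using lower[of "- x"] x y c by simp
      qed
    qed
  qed
qed

section \<open>The stationary point\<close>

text \<open>The condition \<open>\<chi>(u) \<ge> 0\<close> only bounds a supremum. When that supremum is \<open>0\<close> and is approached from
  the left, continuity of \<open>f\<close> puts \<open>0\<close> itself into \<open>{f \<le> 0}\<close>.\<close>

lemma riccati_sublevel_meets_nonneg:
  assumes P: "admissible P" "endpoint_moment P" and u: "u \<in> calX P"
  obtains c where "0 \<le> c" "c \<in> D_X P" "riccati_drift P u c \<le> 0"
proof -
  have uZ: "u \<in> D_Z P" and chi: "0 \<le> chi P u" using u by (auto simp: calX_def)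
  note rhs = riccati_drift_formula(2)[OF P(1) uZ]
  note zero = zero_in_D_X[OF P(1)]
  show thesis
  proof (cases "\<exists>c\<ge>0. c \<in> D_X P \<and> riccati_drift P u c \<le> 0")
    case True
    then show ?thesis using that by blast
  next
    case False
    have "riccati_drift P u 0 \<le> 0"
    proof (rule ccontr)
      assume "\<not> riccati_drift P u 0 \<le> 0"
      then have pos: "0 < riccati_drift P u 0" by simp
      have "continuous_on {-1..0} (riccati_drift P u)"
        by (rule riccati_drift_continuous[OF P uZ zero])
      then have "\<forall>e>0. \<exists>d>0. \<forall>x\<in>{-1..0}. dist x 0 < d \<longrightarrow>
          dist (riccati_drift P u x) (riccati_drift P u 0) < e"
        unfolding continuous_on_iff by (rule bspec) simp
      then obtain d where d: "0 < d" "\<And>x. x \<in> {-1..0} \<Longrightarrow> dist x 0 < d \<Longrightarrow>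
          dist (riccati_drift P u x) (riccati_drift P u 0) < riccati_drift P u 0"
        using pos by blast
      have "ereal (max (-1) (- d)) < chi P u"
        using d chi by (intro less_le_trans[OF _ chi]) (simp add: zero_ereal_def)
      then obtain x where x: "x \<in> D_X P" "riccati_rhs P u x \<le> 0" "max (-1) (- d) < x"
        unfolding chi_def less_SUP_iff by auto
      then have "riccati_drift P u x \<le> 0" using rhs[OF x(1)] by (simp add: zero_ereal_def)
      moreover have "x < 0" using False calculation x(1) not_le by blast
      ultimately show False using d(2)[of x] x(3) by (simp add: dist_real_def)
    qed
    then show ?thesis using that[of 0] zero by simp
  qed
qed

text \<open>Continuity makes the infimum \<open>m\<close> of \<open>{f \<le> 0}\<close> a zero of \<open>f\<close>: \<open>f m \<le> 0\<close> because the part of the set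
  on the left of \<open>c\<close> is closed, and \<open>f m \<ge> 0\<close> as a limit of positive values from the left. If
  \<open>m < 0\<close> and \<open>f 0 \<noteq> 0\<close>, convexity forces \<open>f 0 < 0\<close>, and the chord from \<open>m\<close> to \<open>0\<close> then keeps \<open>f\<close>
  negative in between.\<close>

lemma xi_stationary:
  assumes P: "admissible P" "endpoint_moment P" "0 < b_X P" and u: "u \<in> calX P"
  shows "xi P u \<in> D_X P" "riccati_drift P u (xi P u) = 0"
    and "\<And>x. 0 \<le> x \<Longrightarrow> x < xi P u \<Longrightarrow> 0 < riccati_drift P u x"
    and "\<And>x. xi P u < x \<Longrightarrow> x \<le> 0 \<Longrightarrow> riccati_drift P u x < 0"
proof -
  let ?f = "riccati_drift P u"
  have uZ: "u \<in> D_Z P" using u by (simp add: calX_def)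
  note rhs = riccati_drift_formula(2)[OF P(1) uZ]
  note zero = zero_in_D_X[OF P(1)]
  note down = D_X_downward
  note cont = riccati_drift_continuous[OF P(1,2) uZ]
  obtain c where c: "0 \<le> c" "c \<in> D_X P" "?f c \<le> 0"
    using riccati_sublevel_meets_nonneg[OF P(1,2) u] .
  define S where "S = {x \<in> D_X P. ?f x \<le> 0}"
  have Seq: "{x \<in> D_X P. riccati_rhs P u x \<le> 0} = S"
    using rhs by (auto simp: S_def zero_ereal_def)
  have bdd: "bdd_below S" unfolding S_def by (rule riccati_sublevel_bdd_below[OF P(1) uZ P(3)])
  have f0: "?f 0 = real_of_ereal (Xi P u)"
    using riccati_drift_formula(1)[OF P(1) uZ zero] by simp
  obtain r where r: "Xi P u = ereal r" using Xi_finite[OF P(1) uZ] .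
  have Xi0: "Xi P u = 0 \<longleftrightarrow> ?f 0 = 0" using f0 r by (simp add: zero_ereal_def)
  define m where "m = Inf S"
  have cS: "c \<in> S" using c by (simp add: S_def)
  have mc: "m \<le> c" unfolding m_def by (rule cInf_lower[OF cS bdd])
  have mD: "m \<in> D_X P" by (rule down[OF c(2) mc])
  have above: "0 < ?f x" if "x < m" for x
  proof (rule ccontr)
    assume "\<not> 0 < ?f x"
    then have "x \<in> S" using down[OF mD, of x] that by (simp add: S_def)
    then show False using cInf_lower[OF _ bdd, of x] that by (simp add: m_def)
  qed
  have fm: "?f m = 0"
  proof (rule antisym)
    define T where "T = {m..c} \<inter> ?f -` {..0}"
    have T: "T = S \<inter> {..c}"
      using down[OF c(2)] cInf_lower[OF _ bdd] by (auto simp: T_def S_def m_def)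
    have "closed T" unfolding T_def
      by (intro continuous_closed_preimage cont c(2)) auto
    moreover have bT: "bdd_below T" using T bdd by (auto intro: bdd_below_mono)
    moreover have "c \<in> T" using cS T by simp
    ultimately have "Inf T \<in> T" by (intro closed_contains_Inf) auto
    moreover have "Inf T = m"
    proof (rule antisym)
      show "m \<le> Inf T" using \<open>c \<in> T\<close> by (intro cInf_greatest) (auto simp: T_def)
      show "Inf T \<le> m" unfolding m_def
      proof (rule cInf_greatest)
        show "S \<noteq> {}" using cS by auto
        fix x assume x: "x \<in> S"
        show "Inf T \<le> x"
        proof (cases "x \<le> c")
          case True
          then show ?thesis using x T by (intro cInf_lower bT) auto
        next
          case False
          then show ?thesis using cInf_lower[OF \<open>c \<in> T\<close> bT] by simp
        qed
      qed
    qed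
    ultimately show "?f m \<le> 0" by (simp add: T_def)
    show "0 \<le> ?f m"
    proof (rule tendsto_lowerbound)
      show "(?f \<longlongrightarrow> ?f m) (at m within {m - 1..<m})"
        by (rule tendsto_within_subset[OF cont[OF mD, of "m - 1", unfolded continuous_on_def, rule_format]])
          auto
      show "eventually (\<lambda>x. 0 \<le> ?f x) (at m within {m - 1..<m})"
        unfolding eventually_at by (intro exI[of _ 1]) (use above in \<open>force intro: less_imp_le\<close>)
      show "at m within {m - 1..<m} \<noteq> bot"
        by (simp add: at_within_eq_bot_iff trivial_limit_within islimpt_in_closure closure_atLeastLessThan)
    qed
  qed
  have xi_eq: "xi P u = m" if "?f 0 \<noteq> 0"
    using that Xi0 by (simp add: xi_def Seq m_def)
  have xi_0: "xi P u = 0" if "?f 0 = 0" using that Xi0 by (simp add: xi_def)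
  show "xi P u \<in> D_X P" "?f (xi P u) = 0"
    using xi_eq xi_0 mD fm zero by (cases "?f 0 = 0"; simp)+
  show "0 < ?f x" if "0 \<le> x" "x < xi P u" for x
    using that above xi_eq xi_0 by (cases "?f 0 = 0") auto
  show "?f x < 0" if x: "xi P u < x" "x \<le> 0" for x
  proof -
    have f0ne: "?f 0 \<noteq> 0" using x xi_0 by auto
    then have m: "m < x" "m < 0" using x xi_eq by auto
    have "?f 0 < 0"
    proof (rule ccontr)
      assume "\<not> ?f 0 < 0"
      then have pos: "0 < ?f 0" using f0ne by simp
      then have "0 < c" using c by (cases "c = 0") auto
      \<comment> \<open>The weight that represents \<open>0\<close> as a convex combination of \<open>m\<close> and \<open>c\<close>.\<close>
      define t where "t = - m / (c - m)"
      have t: "0 \<le> t" "t \<le> 1" using m \<open>0 < c\<close> by (auto simp: t_def field_simps)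
      have "(1 - t) * m + t * c = 0" using m \<open>0 < c\<close> by (simp add: t_def field_simps)
      then have "?f 0 \<le> t * ?f c" using riccati_drift_convex[OF P(1) uZ mD c(2) t] fm by simp
      also have "\<dots> \<le> 0" using t c(3) by (simp add: mult_nonneg_nonpos)
      finally show False using pos by simp
    qed
    \<comment> \<open>The weight that represents \<open>x\<close> as a convex combination of \<open>m\<close> and \<open>0\<close>.\<close>
    define t where "t = (x - m) / (- m)"
    have t: "0 < t" "t \<le> 1" using m x by (auto simp: t_def field_simps)
    have "(1 - t) * m + t * 0 = x" using m by (simp add: t_def field_simps)
    then have "?f x \<le> t * ?f 0" using riccati_drift_convex[OF P(1) uZ mD zero, of t] t fm by simp
    also have "\<dots> < 0" using t \<open>?f 0 < 0\<close> by (simp add: mult_pos_neg)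
    finally show ?thesis .
  qed
qed

section \<open>The Riccati flow and its long-time behaviour\<close>

text \<open>The falling case \<open>\<xi>(u) < 0\<close> becomes the rising one under the reflection \<open>x \<mapsto> - x\<close>.\<close>

lemma riccati_global_flow:
  assumes P: "admissible P" "endpoint_moment P" "0 < b_X P" and u: "u \<in> calX P"
  obtains V where "V 0 = 0" "\<And>t. 0 \<le> t \<Longrightarrow> V t \<in> {min 0 (xi P u)..max 0 (xi P u)}"
    "\<And>t. 0 \<le> t \<Longrightarrow> (V has_real_derivative riccati_drift P u (V t)) (at t)"
    "(V \<longlongrightarrow> xi P u) at_top"
proof -
  let ?f = "riccati_drift P u"
  have uZ: "u \<in> D_Z P" using u by (simp add: calX_def)
  note xi = xi_stationary[OF assms]
  consider "xi P u = 0" | "0 < xi P u" | "xi P u < 0" by linarith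
  then show thesis
  proof cases
    case 1
    then show ?thesis using xi(2) by (intro that[of "\<lambda>_. 0"]) auto
  next
    case 2
    obtain L where L: "L-lipschitz_on {0..xi P u} ?f"
      using riccati_drift_lipschitz[OF P(1,2) uZ xi(1)] .
    obtain V where "V 0 = 0" "\<And>t. 0 \<le> t \<Longrightarrow> V t \<in> {0..xi P u}"
      "\<And>t. 0 \<le> t \<Longrightarrow> (V has_real_derivative ?f (V t)) (at t)" "(V \<longlongrightarrow> xi P u) at_top"
      using autonomous_flow_to_zero[OF 2 L xi(3) xi(2)] by metis
    with 2 show ?thesis by (intro that[of V]) auto
  next
    case 3
    obtain L where L: "L-lipschitz_on {xi P u..0} ?f"
      using riccati_drift_lipschitz[OF P(1,2) uZ zero_in_D_X[OF P(1)]] .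
    define g where "g x = - ?f (- x)" for x
    have "L-lipschitz_on {0..- xi P u} g"
    proof (rule lipschitz_onI)
      fix x y assume "x \<in> {0..- xi P u}" "y \<in> {0..- xi P u}"
      then show "dist (g x) (g y) \<le> L * dist x y"
        using lipschitz_onD[OF L, of "- x" "- y"] by (simp add: g_def dist_minus)
    qed (rule lipschitz_on_nonneg[OF L])
    moreover have "0 < g x" if "0 \<le> x" "x < - xi P u" for x using xi(4)[of "- x"] that by (simp add: g_def)
    moreover have "g (- xi P u) = 0" using xi(2) by (simp add: g_def)
    ultimately obtain V where V: "V 0 = 0" "\<And>t. 0 \<le> t \<Longrightarrow> V t \<in> {0..- xi P u}"
      "\<And>t. 0 \<le> t \<Longrightarrow> (V has_real_derivative g (V t)) (at t)" "(V \<longlongrightarrow> - xi P u) at_top"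
      using autonomous_flow_to_zero[of 0 "- xi P u" L g] 3 by auto
    show ?thesis
    proof (rule that[of "\<lambda>t. - V t"])
      show "((\<lambda>t. - V t) has_real_derivative ?f (- V t)) (at t)" if "0 \<le> t" for t
        using DERIV_minus[OF V(3)[OF that]] by (simp add: g_def)
      show "((\<lambda>t. - V t) \<longlongrightarrow> xi P u) at_top" using tendsto_minus[OF V(4)] by simp
      show "- V t \<in> {min 0 (xi P u)..max 0 (xi P u)}" if "0 \<le> t" for t
        using V(2)[OF that] 3 by auto
    qed (use V(1) in simp)
  qed
qed

text \<open>Solutions may come with different lifetimes. On \<open>[0, t]\<close> both are continuous, hence attain their
  maxima, which belong to \<open>\<D>\<^sub>X\<close>; so both stay in a compact interval inside \<open>\<D>\<^sub>X\<close>, where \<open>f\<close> is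
  Lipschitz.\<close>

lemma riccati_solution_unique:
  assumes P: "admissible P" "endpoint_moment P" "u \<in> D_Z P"
    and sol: "riccati_solution P u T U V" "riccati_solution P u T' U' V'"
    and t: "0 \<le> t" "ereal t < T" "ereal t < T'"
  shows "V t = V' t \<and> U t = U' t"
proof -
  have sub: "{0..t} \<subseteq> {s. 0 \<le> s \<and> ereal s < T}" "{0..t} \<subseteq> {s. 0 \<le> s \<and> ereal s < T'}"
    using t by (auto intro: le_less_trans[rotated])
  have D: "V s \<in> D_X P" "(V has_real_derivative riccati_drift P u (V s)) (at s within {0..t})"
      "V' s \<in> D_X P" "(V' has_real_derivative riccati_drift P u (V' s)) (at s within {0..t})"
    if "s \<in> {0..t}" for s
    using sol sub that unfolding riccati_solution_def riccati_drift_def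
    by (blast intro: has_field_derivative_subset)+
  have cont: "continuous_on {0..t} V" "continuous_on {0..t} V'"
    by (rule DERIV_continuous_on, rule D, assumption)+
  have ne: "{0..t} \<noteq> {}" using t by simp
  obtain p q where pq: "p \<in> {0..t}" "\<And>s. s \<in> {0..t} \<Longrightarrow> V s \<le> V p" "q \<in> {0..t}" "\<And>s. s \<in> {0..t} \<Longrightarrow> V' s \<le> V' q"
    using continuous_attains_sup[OF compact_Icc ne cont(1)] continuous_attains_sup[OF compact_Icc ne cont(2)] by metis
  obtain p' q' where pq': "\<And>s. s \<in> {0..t} \<Longrightarrow> V p' \<le> V s" "\<And>s. s \<in> {0..t} \<Longrightarrow> V' q' \<le> V' s"
    using continuous_attains_inf[OF compact_Icc ne cont(1)] continuous_attains_inf[OF compact_Icc ne cont(2)] by metis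
  define a where "a = min (V p') (V' q')"
  define b where "b = max (V p) (V' q)"
  have "b \<in> D_X P" using D(1)[OF pq(1)] D(3)[OF pq(3)] by (simp add: b_def max_def)
  then obtain L where L: "L-lipschitz_on {a..b} (riccati_drift P u)"
    using riccati_drift_lipschitz[OF P] by metis
  have init: "V 0 = V' 0" using sol by (simp add: riccati_solution_def)
  have eq: "V s = V' s" if s: "s \<in> {0..t}" for s
  proof (rule autonomous_flow_unique[OF L, where V=V and W=V' and t=s])
    have ss: "{0..s} \<subseteq> {0..t}" using s by auto
    fix r assume "r \<in> {0..s}"
    then have r: "r \<in> {0..t}" using ss by auto
    show "(V has_real_derivative riccati_drift P u (V r)) (at r within {0..s})"
      "(V' has_real_derivative riccati_drift P u (V' r)) (at r within {0..s})"
      using D(2,4)[OF r] ss by (auto intro: has_field_derivative_subset)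
    show "V r \<in> {a..b}" "V' r \<in> {a..b}"
      using pq(2,4)[OF r] pq'[OF r] by (auto simp: a_def b_def)
  qed (use s init in auto)
  have U: "((\<lambda>s. real_of_ereal (Psi P (V s))) has_integral U t) {0..t}"
    "((\<lambda>s. real_of_ereal (Psi P (V' s))) has_integral U' t) {0..t}"
    using sol t unfolding riccati_solution_def by auto
  from U(2) have "((\<lambda>s. real_of_ereal (Psi P (V s))) has_integral U' t) {0..t}"
    by (rule has_integral_eq[rotated]) (simp add: eq)
  with U(1) have "U t = U' t" by (rule has_integral_unique)
  then show ?thesis using eq[of t] t by simp
qed

theorem proposition3p8:
  fixes P :: cbitcl_params and x0 :: real and \<Omega> :: "'a measure"
    and X Z :: "real \<Rightarrow> 'a \<Rightarrow> real"
  assumes "admissible P"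
    and "CBITCL P x0 \<Omega> X Z"
    and "b_X P > 0"
    and "min (psi_sup P) (phi_sup P) < \<infinity> \<Longrightarrow>
      (\<integral>\<^sup>+x\<in>{1..}. ennreal (x * exp (real_of_ereal (min (psi_sup P) (phi_sup P)) * x)) \<partial>levy_pi P) < \<infinity>"
  shows "\<forall>u\<in>calX P.
    (calV P u \<longlongrightarrow> xi P u) at_top \<and>
    ((\<lambda>t. ereal (1 / t * calU P u t)) \<longlongrightarrow> Psi P (xi P u)) at_top"
proof
  fix u assume u: "u \<in> calX P"
  have P: "admissible P" "endpoint_moment P" "0 < b_X P"
    using assms by (auto simp: endpoint_moment_def)
  have uZ: "u \<in> D_Z P" using u by (simp add: calX_def)
  obtain V where V: "V 0 = 0" "\<And>t. 0 \<le> t \<Longrightarrow> V t \<in> {min 0 (xi P u)..max 0 (xi P u)}"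
    "\<And>t. 0 \<le> t \<Longrightarrow> (V has_real_derivative riccati_drift P u (V t)) (at t)"
    "(V \<longlongrightarrow> xi P u) at_top"
    using riccati_global_flow[OF P u] by metis
  define a b where "a = min 0 (xi P u)" and "b = max 0 (xi P u)"
  define h where "h s = real_of_ereal (Psi P (V s))" for s
  define U where "U t = integral {0..t} h" for t
  have xiD: "xi P u \<in> D_X P" by (rule xi_stationary(1)[OF P u])
  have bD: "b \<in> D_X P" using xiD zero_in_D_X[OF P(1)] by (simp add: b_def max_def)
  have Vab: "V t \<in> {a..b}" if "0 \<le> t" for t using V(2)[OF that] by (simp add: a_def b_def)
  have Psi_cont: "continuous_on {a..b} (\<lambda>v. real_of_ereal (Psi P v))" by (rule Psi_continuous[OF P(1) bD])
  have "continuous_on {0..} V"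
    by (rule DERIV_continuous_on, rule has_field_derivative_at_within, rule V(3)) simp
  then have h: "continuous_on {0..} h"
    unfolding h_def by (rule continuous_on_compose2[OF Psi_cont]) (use Vab in auto)
  have sol: "riccati_solution P u \<infinity> U V"
    unfolding riccati_solution_def
  proof (intro conjI allI impI)
    fix t :: real assume t: "0 \<le> t \<and> ereal t < \<infinity>"
    show "V t \<in> D_X P" using D_X_downward[OF bD] Vab[of t] t by simp
    have "h integrable_on {0..t}"
      by (rule integrable_continuous_real) (auto intro: continuous_on_subset[OF h])
    then show "((\<lambda>s. real_of_ereal (Psi P (V s))) has_integral U t) {0..t}"
      unfolding U_def h_def[symmetric] by (rule integrable_integral)
    show "(V has_real_derivative real_of_ereal (riccati_rhs P u (V t))) (at t within {s. 0 \<le> s \<and> ereal s < \<infinity>})"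
      using V(3)[of t] t unfolding riccati_drift_def by (simp add: has_field_derivative_at_within)
  qed (use V(1) in auto)
  have calV: "calV P u t = V t" if "0 \<le> t" for t
    unfolding calV_def
  proof (rule the_equality)
    show "\<exists>T U' V'. riccati_solution P u T U' V' \<and> 0 \<le> t \<and> ereal t < T \<and> V t = V' t"
      using sol that by (intro exI[of _ \<infinity>] exI[of _ U] exI[of _ V]) simp
  qed (use riccati_solution_unique[OF P(1,2) uZ _ sol that] in auto)
  have calU: "calU P u t = U t" if "0 \<le> t" for t
    unfolding calU_def
  proof (rule the_equality)
    show "\<exists>T U' V'. riccati_solution P u T U' V' \<and> 0 \<le> t \<and> ereal t < T \<and> U t = U' t"
      using sol that by (intro exI[of _ \<infinity>] exI[of _ U] exI[of _ V]) simp
  qed (use riccati_solution_unique[OF P(1,2) uZ _ sol that] in auto)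
  have "(calV P u \<longlongrightarrow> xi P u) at_top"
    using V(4)
  proof (rule tendsto_cong[THEN iffD2, rotated])
    show "eventually (\<lambda>t. calV P u t = V t) at_top"
      using eventually_ge_at_top[of 0] by eventually_elim (rule calV)
  qed
  moreover have "((\<lambda>t. ereal (1 / t * calU P u t)) \<longlongrightarrow> Psi P (xi P u)) at_top"
  proof -
    have "(h \<longlongrightarrow> real_of_ereal (Psi P (xi P u))) at_top"
      unfolding h_def
    proof (rule continuous_on_tendsto_compose[OF Psi_cont V(4)])
      show "xi P u \<in> {a..b}" by (simp add: a_def b_def)
      show "eventually (\<lambda>t. V t \<in> {a..b}) at_top"
        using eventually_ge_at_top[of 0] by eventually_elim (rule Vab)
    qed
    from time_average_tendsto[OF h this]
    have "((\<lambda>t. ereal (1 / t * U t)) \<longlongrightarrow> ereal (real_of_ereal (Psi P (xi P u)))) at_top"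
      unfolding U_def by (rule tendsto_ereal)
    also have "ereal (real_of_ereal (Psi P (xi P u))) = Psi P (xi P u)"
      using Psi_eq[OF P(1) xiD] by simp
    finally show ?thesis
    proof (rule tendsto_cong[THEN iffD1, rotated])
      show "eventually (\<lambda>t. ereal (1 / t * U t) = ereal (1 / t * calU P u t)) at_top"
        using eventually_ge_at_top[of 0] by eventually_elim (simp add: calU)
    qed
  qed
  ultimately show "(calV P u \<longlongrightarrow> xi P u) at_top \<and>
    ((\<lambda>t. ereal (1 / t * calU P u t)) \<longlongrightarrow> Psi P (xi P u)) at_top" ..
qed

end
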